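(* Let $\mathbf X=(M,\omega)$ be an arbitrary abelian differential and let $\gamma_i$, $i=1,\dots,k$, be rectangular closed curves on $M$ such that the cycle $\sum_{i=1}^k\gamma_i$ is homologous to $0$. Then for any $\Phi^+\in\mathfrak B_c^+(\mathbf X)$ we have $$\sum_{i=1}^k\Phi^+(\gamma_i)=0.$$
   Context: An abelian differential $\mathbf X=(M,\omega)$ is a compact Riemann surface $M$ of genus $\rho\ge2$ with a nonzero holomorphic one-form $\omega$, of total area $1$ for $\nu=\frac{i}{2}\omega\wedge\overline\omega$. The vertical flow $h_t^+$ is the unit-speed flow along which $\Re\omega=0$ and $\Im\omega$ increases; the horizontal flow $h_t^-$ is the unit-speed flow along which $\Im\omega=0$ and $\Re\omega$ increases. They are defined as long as the orbit does not meet a zero of $\omega$; all conditions are understood where the flow arcs are defined. For $t_1,t_2>0$ the set $\Pi(x,t_1,t_2)=\{h^+_{\tau_1}h^-_{\tau_2}x:\ 0\le\tau_1<t_1,\ 0\le\tau_2<t_2\}$ is an admissible rectangle if it is embedded and its closure contains no zeros of $\omega$. $\mathfrak B_c^+(\mathbf X)$ is the space of real-valued functions $\Phi^+(x,t)$, $x\in M$, $t\in\mathbb R$, such that: (1) $\Phi^+(x,t+s)=\Phi^+(x,t)+\Phi^+(h_t^+x,s)$; (2) for any $\varepsilon>0$ there is $\delta>0$ with $|\Phi^+(x,t)|\le\varepsilon$ for all $x\in M$ and all $|t|<\delta$; (3) $\Phi^+(x,t_1)=\Phi^+(h^-_{t_2}x,t_1)$ whenever $\Pi(x,t_1,t_2)$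 is admissible. A continuous closed curve $\gamma$ on $M$ is rectangular if it is a concatenation of finitely many arcs $\gamma_1^+,\dots,\gamma_{k_1}^+$ of the flow $h_t^+$ and arcs $\gamma_1^-,\dots,\gamma_{k_2}^-$ of the flow $h_t^-$ (each traversed in either direction). Then $\Phi^+(\gamma)=\sum_{i=1}^{k_1}\Phi^+(\gamma_i^+)$, where $\Phi^+([x,h_t^+x])=\Phi^+(x,t)$ for an arc traversed in the direction of the flow, and the opposite sign is taken for an arc traversed against the flow. *)

theory Defs
  imports "HOL-Complex_Analysis.Complex_Analysis" "HOL-Homology.Homology"
begin

section \<open>Riemann surfaces and holomorphic one-forms\<close>

text \<open>
  The surface is the whole of a Hausdorff type; its complex structure is given by a (not
  necessarily maximal) atlas.  The values of a chart map outside the chart domain are irrelevant.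
\<close>

type_synonym 'a chart = "'a set \<times> ('a \<Rightarrow> complex)"

definition complex_atlas :: "'a::t2_space chart set \<Rightarrow> bool" where
  "complex_atlas A \<longleftrightarrow>
     (\<Union>c\<in>A. fst c) = UNIV \<and>
     (\<forall>c\<in>A. open (fst c) \<and> open (snd c ` fst c) \<and>
        homeomorphism (fst c) (snd c ` fst c) (snd c) (inv_into (fst c) (snd c))) \<and>
     (\<forall>c\<in>A. \<forall>d\<in>A.
        (snd d \<circ> inv_into (fst c) (snd c)) holomorphic_on (snd c ` (fst c \<inter> fst d)))"

definition has_genus :: "'a::topological_space itself \<Rightarrow> nat \<Rightarrow> bool" where
  "has_genus (_ :: 'a itself) g \<longleftrightarrow>
     homology_group 1 (euclidean :: 'a topology) \<cong> free_Abelian_group {..<2 * g}"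

definition compact_Riemann_surface :: "'a::t2_space chart set \<Rightarrow> bool" where
  "compact_Riemann_surface A \<longleftrightarrow>
     compact (UNIV :: 'a set) \<and> connected (UNIV :: 'a set) \<and> complex_atlas A"

text \<open>
  A one-form is the family of its coefficient functions: in the chart \<open>c\<close>, with local
  coordinate \<open>z\<close>, it reads \<open>\<omega> c z dz\<close>.
\<close>

type_synonym 'a form = "'a chart \<Rightarrow> complex \<Rightarrow> complex"

definition holomorphic_one_form :: "'a::t2_space chart set \<Rightarrow> 'a form \<Rightarrow> bool" where
  "holomorphic_one_form A \<omega> \<longleftrightarrow>
     (\<forall>c\<in>A. \<omega> c holomorphic_on (snd c ` fst c)) \<and>
     (\<forall>c\<in>A. \<forall>d\<in>A. \<forall>p \<in> fst c \<inter> fst d.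
        \<omega> c (snd c p) =
        \<omega> d (snd d p) * deriv (snd d \<circ> inv_into (fst c) (snd c)) (snd c p))"

definition form_zeros :: "'a chart set \<Rightarrow> 'a form \<Rightarrow> 'a set" where
  "form_zeros A \<omega> = {p. \<exists>c\<in>A. p \<in> fst c \<and> \<omega> c (snd c p) = 0}"

text \<open>
  The measure of the area form \<open>(i/2) \<omega> \<and> cnj \<omega>\<close>: since \<open>(i/2) dz \<and> cnj dz = dx \<and> dy\<close>, it has
  density \<open>|\<omega> c z|\<^sup>2\<close> with respect to Lebesgue measure in the coordinate of each chart \<open>c\<close>.
  As the charts cover the surface, this determines the measure.
\<close>

definition area_measure :: "'a::t2_space chart set \<Rightarrow> 'a form \<Rightarrow> 'a measure \<Rightarrow> bool" where
  "area_measure A \<omega> \<nu> \<longleftrightarrow>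
     sets \<nu> = sets borel \<and>
     (\<forall>c\<in>A. \<forall>B \<in> sets borel. B \<subseteq> fst c \<longrightarrow>
        emeasure \<nu> B =
        (\<integral>\<^sup>+ z. ennreal ((cmod (\<omega> c z))\<^sup>2) * indicator (snd c ` B) z \<partial>lborel))"

definition abelian_differential :: "'a::t2_space chart set \<Rightarrow> 'a form \<Rightarrow> bool" where
  "abelian_differential A \<omega> \<longleftrightarrow>
     compact_Riemann_surface A \<and>
     (\<exists>\<rho>\<ge>2. has_genus TYPE('a) \<rho>) \<and>
     holomorphic_one_form A \<omega> \<and>
     form_zeros A \<omega> \<noteq> UNIV \<and>
     (\<exists>\<nu>. area_measure A \<omega> \<nu> \<and> emeasure \<nu> UNIV = 1)"

section \<open>Vertical and horizontal flows\<close>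

text \<open>
  \<open>g\<close> is an orbit arc from \<open>x\<close>, for time \<open>0\<close> to \<open>t\<close> (of either sign), of the vector field
  on which \<open>\<omega>\<close> takes the constant value \<open>v\<close>.  The direction \<open>v = \<i>\<close> gives the vertical flow and
  \<open>v = 1\<close> the horizontal flow, both of unit speed for the flat metric \<open>|\<omega>|\<close>.
\<close>

definition flow_line ::
    "'a::t2_space chart set \<Rightarrow> 'a form \<Rightarrow> complex \<Rightarrow> real \<Rightarrow> 'a \<Rightarrow> (real \<Rightarrow> 'a) \<Rightarrow> bool" where
  "flow_line A \<omega> v t x g \<longleftrightarrow>
     g 0 = x \<and> continuous_on (closed_segment 0 t) g \<and>
     (\<forall>s \<in> closed_segment 0 t. g s \<notin> form_zeros A \<omega> \<and>
        (\<forall>c\<in>A. g s \<in> fst c \<longrightarrow>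
           (\<exists>w. ((snd c \<circ> g) has_vector_derivative w) (at s within closed_segment 0 t) \<and>
                \<omega> c (snd c (g s)) * w = v)))"

definition flow_defined ::
    "'a::t2_space chart set \<Rightarrow> 'a form \<Rightarrow> complex \<Rightarrow> real \<Rightarrow> 'a \<Rightarrow> bool" where
  "flow_defined A \<omega> v t x \<longleftrightarrow> (\<exists>g. flow_line A \<omega> v t x g)"

text \<open>Meaningful only where \<^const>\<open>flow_defined\<close> holds.\<close>

definition flow ::
    "'a::t2_space chart set \<Rightarrow> 'a form \<Rightarrow> complex \<Rightarrow> real \<Rightarrow> 'a \<Rightarrow> 'a" where
  "flow A \<omega> v t x = (THE y. \<exists>g. flow_line A \<omega> v t x g \<and> g t = y)"

abbreviation "vflow A \<omega> \<equiv> flow A \<omega> \<i>"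
abbreviation "vflow_defined A \<omega> \<equiv> flow_defined A \<omega> \<i>"
abbreviation "hflow A \<omega> \<equiv> flow A \<omega> 1"
abbreviation "hflow_defined A \<omega> \<equiv> flow_defined A \<omega> 1"

section \<open>Admissible rectangles and the space of cocycles\<close>

definition rectangle_map ::
    "'a::t2_space chart set \<Rightarrow> 'a form \<Rightarrow> 'a \<Rightarrow> real \<times> real \<Rightarrow> 'a" where
  "rectangle_map A \<omega> x = (\<lambda>(\<tau>1, \<tau>2). vflow A \<omega> \<tau>1 (hflow A \<omega> \<tau>2 x))"

definition rectangle ::
    "'a::t2_space chart set \<Rightarrow> 'a form \<Rightarrow> 'a \<Rightarrow> real \<Rightarrow> real \<Rightarrow> 'a set" where
  "rectangle A \<omega> x t1 t2 = rectangle_map A \<omega> x ` ({0..<t1} \<times> {0..<t2})"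

definition admissible ::
    "'a::t2_space chart set \<Rightarrow> 'a form \<Rightarrow> 'a \<Rightarrow> real \<Rightarrow> real \<Rightarrow> bool" where
  "admissible A \<omega> x t1 t2 \<longleftrightarrow>
     0 < t1 \<and> 0 < t2 \<and>
     (\<forall>\<tau>1\<in>{0..<t1}. \<forall>\<tau>2\<in>{0..<t2}.
        hflow_defined A \<omega> \<tau>2 x \<and> vflow_defined A \<omega> \<tau>1 (hflow A \<omega> \<tau>2 x)) \<and>
     embedding_map (top_of_set ({0..<t1} \<times> {0..<t2})) euclidean (rectangle_map A \<omega> x) \<and>
     closure (rectangle A \<omega> x t1 t2) \<inter> form_zeros A \<omega> = {}"

text \<open>Each condition is imposed only where the flow arcs occurring in it are defined.\<close>

definition Bc_plus :: "'a::t2_space chart set \<Rightarrow> 'a form \<Rightarrow> ('a \<Rightarrow> real \<Rightarrow> real) set" where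
  "Bc_plus A \<omega> = {\<Phi>.
     (\<forall>x t s. vflow_defined A \<omega> t x \<and> vflow_defined A \<omega> s (vflow A \<omega> t x) \<longrightarrow>
        \<Phi> x (t + s) = \<Phi> x t + \<Phi> (vflow A \<omega> t x) s) \<and>
     (\<forall>\<epsilon>>0. \<exists>\<delta>>0. \<forall>x t. \<bar>t\<bar> < \<delta> \<and> vflow_defined A \<omega> t x \<longrightarrow> \<bar>\<Phi> x t\<bar> \<le> \<epsilon>) \<and>
     (\<forall>x t1 t2. admissible A \<omega> x t1 t2 \<and> vflow_defined A \<omega> t1 x \<and>
        hflow_defined A \<omega> t2 x \<and> vflow_defined A \<omega> t1 (hflow A \<omega> t2 x) \<longrightarrow>
        \<Phi> x t1 = \<Phi> (hflow A \<omega> t2 x) t1)}"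

section \<open>Rectangular closed curves\<close>

text \<open>
  An arc with base point \<open>x\<close> and length \<open>t\<close> is the orbit segment from \<open>x\<close> to its image
  under the time-\<open>t\<close> map; if it is not forward, it is traversed from the latter point to \<open>x\<close>.
\<close>

datatype 'a flow_arc =
  Flow_Arc (vertical: bool) (forward: bool) (arc_base: 'a) (arc_len: real)

definition arc_dir :: "'a flow_arc \<Rightarrow> complex" where
  "arc_dir a = (if vertical a then \<i> else 1)"

definition is_flow_arc :: "'a::t2_space chart set \<Rightarrow> 'a form \<Rightarrow> 'a flow_arc \<Rightarrow> bool" where
  "is_flow_arc A \<omega> a \<longleftrightarrow> 0 \<le> arc_len a \<and> flow_defined A \<omega> (arc_dir a) (arc_len a) (arc_base a)"

definition arc_path :: "'a::t2_space chart set \<Rightarrow> 'a form \<Rightarrow> 'a flow_arc \<Rightarrow> real \<Rightarrow> 'a" where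
  "arc_path A \<omega> a u =
     flow A \<omega> (arc_dir a) (arc_len a * (if forward a then u else 1 - u)) (arc_base a)"

text \<open>
  \<open>g\<close> traverses the arcs of the list \<open>as\<close> in order, each with some monotone parametrization
  \<open>\<theta>\<close>.
\<close>

definition concatenation ::
    "'a::t2_space chart set \<Rightarrow> 'a form \<Rightarrow> (real \<Rightarrow> 'a) \<Rightarrow> 'a flow_arc list \<Rightarrow> bool" where
  "concatenation A \<omega> g as \<longleftrightarrow>
     (\<exists>s :: nat \<Rightarrow> real. s 0 = 0 \<and> s (length as) = 1 \<and>
        (\<forall>j < length as. s j < s (Suc j) \<and>
           (\<exists>\<theta>. continuous_on {s j..s (Suc j)} \<theta> \<and> mono_on {s j..s (Suc j)} \<theta> \<and>
                \<theta> (s j) = 0 \<and> \<theta> (s (Suc j)) = 1 \<and>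
                (\<forall>u \<in> {s j..s (Suc j)}. g u = arc_path A \<omega> (as ! j) (\<theta> u)))))"

definition rectangular_closed_curve ::
    "'a::t2_space chart set \<Rightarrow> 'a form \<Rightarrow> (real \<Rightarrow> 'a) \<Rightarrow> 'a flow_arc list \<Rightarrow> bool" where
  "rectangular_closed_curve A \<omega> g as \<longleftrightarrow>
     path g \<and> pathfinish g = pathstart g \<and>
     (\<forall>a \<in> set as. is_flow_arc A \<omega> a) \<and> concatenation A \<omega> g as"

definition arc_value :: "('a \<Rightarrow> real \<Rightarrow> real) \<Rightarrow> 'a flow_arc \<Rightarrow> real" where
  "arc_value \<Phi> a =
     (if forward a then \<Phi> (arc_base a) (arc_len a) else - \<Phi> (arc_base a) (arc_len a))"

definition curve_value :: "('a \<Rightarrow> real \<Rightarrow> real) \<Rightarrow> 'a flow_arc list \<Rightarrow> real" where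
  "curve_value \<Phi> as = (\<Sum>a\<leftarrow>filter vertical as. arc_value \<Phi> a)"

text \<open>
  A path on \<open>{0..1}\<close> as a singular 1-simplex; the point of \<^term>\<open>standard_simplex 1\<close> with
  barycentric coordinates \<open>(1 - u, u)\<close> corresponds to \<open>u\<close>.
\<close>

definition curve_simplex :: "(real \<Rightarrow> 'a) \<Rightarrow> (nat \<Rightarrow> real) \<Rightarrow> 'a" where
  "curve_simplex g = restrict (\<lambda>b. g (b 1)) (standard_simplex 1)"

end

theory Submission
  imports Defs
begin

text \<open>
  A cocycle \<open>\<Phi>\<close> has local primitives: functions which grow by \<open>\<Phi>\<close> along vertical arcs and are
  constant along horizontal ones.  Invariance under admissible rectangles yields them on flat
  patches, and smallness on short arcs yields them around a zero of the form.  Two local primitives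
  differ by a locally constant function, so every path has a well-defined increment.  The increment
  vanishes on boundaries of singular 2-simplices, because a primitive can be continued over a whole
  simplex, and it equals \<open>\<Phi>(\<gamma>)\<close> on a rectangular curve \<open>\<gamma>\<close>.
\<close>

section \<open>Primitives along maps\<close>

text \<open>The obstacle is a zero \<open>p\<close> of the form. No flow line meets it, so
  \<open>\<Phi>\<close> has no values there, and with total angle \<open>2 * pi * n\<close> around
  \<open>p\<close> a primitive continued once around could return with a different value. The curves
  avoid the zeros, but the 2-simplices that they bound need not, so germs are required at zeros as
  well. Germs are indexed by points and compared in two stages, \<open>q\<close> near
  \<open>p\<close> and then \<open>y\<close> near \<open>q\<close>. The second neighbourhood may
  shrink as \<open>q\<close> approaches \<open>p\<close>, as flat coordinates do when
  \<open>q\<close> tends to a zero. This weak form suffices, because a primitive is tested one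
  parameter at a time. Primitives live on the domain of a map into the surface, not on subsets of
  the surface: a singular simplex need not be injective, while its domain has no topology that could
  obstruct the continuation.\<close>

text \<open>\<open>G p\<close> stands for a local primitive near \<open>p\<close> vanishing at \<open>p\<close>.\<close>

definition locally_additive :: "('a::topological_space \<Rightarrow> 'a \<Rightarrow> real) \<Rightarrow> bool" where
  "locally_additive G \<longleftrightarrow>
     (\<forall>p. \<forall>\<^sub>F q in nhds p. \<forall>\<^sub>F y in nhds q. G q y = G p y - G p q)"

definition primitive_along ::
    "('a::topological_space \<Rightarrow> 'a \<Rightarrow> real) \<Rightarrow> ('b::topological_space \<Rightarrow> 'a) \<Rightarrow> 'b set \<Rightarrow> ('b \<Rightarrow> real) \<Rightarrow> bool"
  where "primitive_along G f D \<phi> \<longleftrightarrow>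
     (\<forall>s\<in>D. \<forall>\<^sub>F t in nhds s. t \<in> D \<longrightarrow> \<phi> t - \<phi> s = G (f s) (f t))"

lemma locally_additive_self:
  assumes "locally_additive G"
  shows "G p p = 0"
proof -
  have "\<forall>\<^sub>F q in nhds p. \<forall>\<^sub>F y in nhds q. G q y = G p y - G p q"
    using assms unfolding locally_additive_def by blast
  then have "\<forall>\<^sub>F y in nhds p. G p y = G p y - G p p"
    by (rule eventually_nhds_x_imp_x)
  then have "G p p = G p p - G p p"
    by (rule eventually_nhds_x_imp_x)
  then show ?thesis by simp
qed

text \<open>The increments of both primitives are prescribed by the same \<open>G\<close>, so their
  difference is locally constant. This makes all increments independent of the chosen
  primitive.\<close>

lemma primitive_along_diff_const:
  assumes "connected D" "primitive_along G f D \<phi>" "primitive_along G f D \<psi>" "a \<in> D" "b \<in> D"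
  shows "\<phi> b - \<phi> a = \<psi> b - \<psi> a"
proof -
  have "\<phi> a - \<psi> a = \<phi> b - \<psi> b"
  proof (rule connected_local_const[where f = "\<lambda>t. \<phi> t - \<psi> t", OF assms(1,4,5)])
    show "\<forall>s\<in>D. \<forall>\<^sub>F t in at s within D. \<phi> s - \<psi> s = \<phi> t - \<psi> t"
    proof
      fix s assume "s \<in> D"
      then have "\<forall>\<^sub>F t in nhds s. t \<in> D \<longrightarrow> \<phi> t - \<phi> s = G (f s) (f t)"
        "\<forall>\<^sub>F t in nhds s. t \<in> D \<longrightarrow> \<psi> t - \<psi> s = G (f s) (f t)"
        using assms unfolding primitive_along_def by auto
      then show "\<forall>\<^sub>F t in at s within D. \<phi> s - \<psi> s = \<phi> t - \<psi> t"
        unfolding eventually_at_filter by eventually_elim auto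
    qed
  qed
  then show ?thesis by simp
qed

lemma primitive_along_subset:
  "primitive_along G f D \<phi> \<Longrightarrow> E \<subseteq> D \<Longrightarrow> primitive_along G f E \<phi>"
  unfolding primitive_along_def by (blast intro: eventually_mono)

lemma primitive_along_compose:
  assumes "primitive_along G f D \<phi>" "continuous_on E \<theta>" "\<theta> ` E \<subseteq> D"
  shows "primitive_along G (f \<circ> \<theta>) E (\<phi> \<circ> \<theta>)"
  unfolding primitive_along_def
proof
  fix s assume "s \<in> E"
  then have "\<forall>\<^sub>F t in nhds (\<theta> s). t \<in> D \<longrightarrow> \<phi> t - \<phi> (\<theta> s) = G (f (\<theta> s)) (f t)"
    using assms unfolding primitive_along_def by blast
  then obtain S where S: "open S" "\<theta> s \<in> S"
    "\<And>t. t \<in> S \<Longrightarrow> t \<in> D \<Longrightarrow> \<phi> t - \<phi> (\<theta> s) = G (f (\<theta> s)) (f t)"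
    unfolding eventually_nhds by blast
  obtain T where "open T" "s \<in> T" "\<And>t. t \<in> E \<Longrightarrow> t \<in> T \<Longrightarrow> \<theta> t \<in> S"
    using assms(2) S(1,2) \<open>s \<in> E\<close> unfolding continuous_on_topological by metis
  then show "\<forall>\<^sub>F t in nhds s. t \<in> E \<longrightarrow> (\<phi> \<circ> \<theta>) t - (\<phi> \<circ> \<theta>) s = G ((f \<circ> \<theta>) s) ((f \<circ> \<theta>) t)"
    unfolding eventually_nhds using S(3) assms(3) by (intro exI[of _ T]) auto
qed

lemma primitive_along_cong:
  assumes "primitive_along G f D \<phi>" "\<And>s. s \<in> D \<Longrightarrow> f s = g s" "\<And>s. s \<in> D \<Longrightarrow> \<phi> s = \<psi> s"
  shows "primitive_along G g D \<psi>"
  using assms unfolding primitive_along_def by (auto elim!: eventually_mono)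

lemma primitive_along_glue:
  assumes "primitive_along G f D \<phi>" "primitive_along G f E \<psi>" "closed D" "closed E"
    and c: "\<And>s. s \<in> D \<Longrightarrow> s \<in> E \<Longrightarrow> \<phi> s = \<psi> s + c"
  shows "primitive_along G f (D \<union> E) (\<lambda>s. if s \<in> D then \<phi> s else \<psi> s + c)"
  unfolding primitive_along_def
proof
  fix s assume s: "s \<in> D \<union> E"
  \<comment> \<open>The conjunct \<open>s \<in> D\<close> is where closedness enters: points of
    \<open>D\<close> arbitrarily close to \<open>s\<close> exist only if \<open>s\<close> itself
    lies in \<open>D\<close>.\<close>
  have 1: "\<forall>\<^sub>F t in nhds s. t \<in> D \<longrightarrow> s \<in> D \<and> \<phi> t - \<phi> s = G (f s) (f t)"
  proof (cases "s \<in> D")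
    case True
    then show ?thesis using assms(1) unfolding primitive_along_def by simp
  next
    case False
    then have "\<forall>\<^sub>F t in nhds s. t \<in> - D"
      using assms(3) by (intro eventually_nhds_in_open) auto
    then show ?thesis by eventually_elim auto
  qed
  have 2: "\<forall>\<^sub>F t in nhds s. t \<in> E \<longrightarrow> s \<in> E \<and> \<psi> t - \<psi> s = G (f s) (f t)"
  proof (cases "s \<in> E")
    case True
    then show ?thesis using assms(2) unfolding primitive_along_def by simp
  next
    case False
    then have "\<forall>\<^sub>F t in nhds s. t \<in> - E"
      using assms(4) by (intro eventually_nhds_in_open) auto
    then show ?thesis by eventually_elim auto
  qed
  from 1 2 show "\<forall>\<^sub>F t in nhds s. t \<in> D \<union> E \<longrightarrow>
      (if t \<in> D then \<phi> t else \<psi> t + c) - (if s \<in> D then \<phi> s else \<psi> s + c) = G (f s) (f t)"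
    by eventually_elim (auto simp: c)
qed

text \<open>On a connected overlap the two primitives differ by one constant, so a single shift
  suffices. Different constants on different components would be monodromy.\<close>

lemma primitive_along_glue_ex:
  assumes "primitive_along G f D \<phi>" "primitive_along G f E \<psi>" "closed D" "closed E"
    "connected (D \<inter> E)"
  shows "\<exists>\<eta>. primitive_along G f (D \<union> E) \<eta>"
proof (cases "D \<inter> E = {}")
  case True
  then show ?thesis
    using primitive_along_glue[OF assms(1-4), of 0] by blast
next
  case False
  then obtain a where a: "a \<in> D \<inter> E" by blast
  have "\<phi> s = \<psi> s + (\<phi> a - \<psi> a)" if "s \<in> D" "s \<in> E" for s
    using primitive_along_diff_const[OF assms(5), of G f \<phi> \<psi> a s] that a
      primitive_along_subset[OF assms(1), of "D \<inter> E"] primitive_along_subset[OF assms(2), of "D \<inter> E"]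
    by simp
  then show ?thesis
    using primitive_along_glue[OF assms(1-4)] by blast
qed

text \<open>The germ at \<open>f s\<close> serves at all nearby parameters \<open>r\<close> too:
  \<open>locally_additive\<close> with \<open>q = f r\<close> and \<open>y = f t\<close> is exactly
  the test at \<open>r\<close>.\<close>

lemma primitive_along_local:
  assumes "locally_additive G" "continuous_on D f" "s \<in> D"
  shows "\<exists>T. open T \<and> s \<in> T \<and> primitive_along G f (D \<inter> T) (\<lambda>t. G (f s) (f t))"
proof -
  have "\<forall>\<^sub>F q in nhds (f s). \<forall>\<^sub>F y in nhds q. G q y = G (f s) y - G (f s) q"
    using assms unfolding locally_additive_def by blast
  then obtain S where S: "open S" "f s \<in> S"
    "\<And>q. q \<in> S \<Longrightarrow> \<forall>\<^sub>F y in nhds q. G q y = G (f s) y - G (f s) q"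
    unfolding eventually_nhds[of _ "f s"] by blast
  obtain T where T: "open T" "s \<in> T" "\<And>t. t \<in> D \<Longrightarrow> t \<in> T \<Longrightarrow> f t \<in> S"
    using assms(2,3) S(1,2) unfolding continuous_on_topological by metis
  have "primitive_along G f (D \<inter> T) (\<lambda>t. G (f s) (f t))"
    unfolding primitive_along_def
  proof
    fix r assume r: "r \<in> D \<inter> T"
    then obtain W where W: "open W" "f r \<in> W"
      "\<And>y. y \<in> W \<Longrightarrow> G (f r) y = G (f s) y - G (f s) (f r)"
      using S(3)[of "f r"] T(3)[of r] unfolding eventually_nhds by blast
    obtain V where "open V" "r \<in> V" "\<And>t. t \<in> D \<Longrightarrow> t \<in> V \<Longrightarrow> f t \<in> W"
      using assms(2) r W(1,2) unfolding continuous_on_topological by (metis IntD1)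
    then show "\<forall>\<^sub>F t in nhds r. t \<in> D \<inter> T \<longrightarrow> G (f s) (f t) - G (f s) (f r) = G (f r) (f t)"
      unfolding eventually_nhds using W(3) by (intro exI[of _ V]) auto
  qed
  with T show "\<exists>T. open T \<and> s \<in> T \<and> primitive_along G f (D \<inter> T) (\<lambda>t. G (f s) (f t))"
    by blast
qed

text \<open>Bisection in one coordinate after the other; neighbouring rectangles are glued along a
  common side.\<close>

lemma primitive_along_rectangle:
  fixes f :: "real \<times> real \<Rightarrow> 'a::topological_space"
  assumes G: "locally_additive G" and f: "continuous_on ({a..b} \<times> {c..d}) f"
    and le: "a \<le> b" "c \<le> d"
  obtains \<phi> where "primitive_along G f ({a..b} \<times> {c..d}) \<phi>"
proof -
  have seg: "connected ({x..y} \<times> {z..w})" "closed ({x..y} \<times> {z..w})" for x y z w :: real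
    by (auto intro!: connected_Times closed_Times)
  have glue1: "\<exists>\<phi>. primitive_along G f ({x1..x2} \<times> {y1..y3}) \<phi>"
    if "\<exists>\<phi>. primitive_along G f ({x1..x2} \<times> {y1..y2}) \<phi>"
       "\<exists>\<phi>. primitive_along G f ({x1..x2} \<times> {y2..y3}) \<phi>" "y1 \<le> y2" "y2 \<le> y3"
    for x1 x2 y1 y2 y3
  proof -
    have "{x1..x2} \<times> {y1..y2} \<inter> {x1..x2} \<times> {y2..y3} = {x1..x2} \<times> {y2..y2}"
      "{x1..x2} \<times> {y1..y2} \<union> {x1..x2} \<times> {y2..y3} = {x1..x2} \<times> {y1..y3}"
      using that(3,4) by auto
    then show ?thesis
      using that(1,2) primitive_along_glue_ex[OF _ _ seg(2,2), of G f x1 x2 y1 y2 _ x1 x2 y2 y3] seg(1)[of x1 x2 y2 y2]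
      by auto
  qed
  have glue2: "\<exists>\<phi>. primitive_along G f ({x1..x3} \<times> {y1..y2}) \<phi>"
    if "\<exists>\<phi>. primitive_along G f ({x1..x2} \<times> {y1..y2}) \<phi>"
       "\<exists>\<phi>. primitive_along G f ({x2..x3} \<times> {y1..y2}) \<phi>" "x1 \<le> x2" "x2 \<le> x3"
    for x1 x2 x3 y1 y2
  proof -
    have "{x1..x2} \<times> {y1..y2} \<inter> {x2..x3} \<times> {y1..y2} = {x2..x2} \<times> {y1..y2}"
      "{x1..x2} \<times> {y1..y2} \<union> {x2..x3} \<times> {y1..y2} = {x1..x3} \<times> {y1..y2}"
      using that(3,4) by auto
    then show ?thesis
      using that(1,2) primitive_along_glue_ex[OF _ _ seg(2,2), of G f x1 x2 y1 y2 _ x2 x3 y1 y2] seg(1)[of x2 x2 y1 y2]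
      by auto
  qed
  \<comment> \<open>First a whole strip over a short interval around \<open>x\<close>; its width
    \<open>e\<close> comes from compactness of the vertical side.\<close>
  have strip: "\<exists>e>0. \<forall>x1 x2. a \<le> x1 \<and> x1 \<le> x \<and> x \<le> x2 \<and> x2 \<le> b \<and> x2 - x1 < e \<longrightarrow>
      (\<exists>\<phi>. primitive_along G f ({x1..x2} \<times> {c..d}) \<phi>)" if x: "a \<le> x" "x \<le> b" for x
  proof -
    \<comment> \<open>The width is quantified inside \<open>?P\<close>, so that joining two pieces
      may shrink it to \<open>min e1 e2\<close>. The guards on \<open>y1\<close> and
      \<open>y2\<close> are there because \<open>Bolzano\<close> also tests small intervals that
      stick out of \<open>{c..d}\<close>.\<close>
    let ?P = "\<lambda>y1 y2. c \<le> y1 \<and> y2 \<le> d \<longrightarrow> 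
      (\<exists>e>0. \<forall>x1 x2. a \<le> x1 \<and> x1 \<le> x \<and> x \<le> x2 \<and> x2 \<le> b \<and> x2 - x1 < e \<longrightarrow>
        (\<exists>\<phi>. primitive_along G f ({x1..x2} \<times> {y1..y2}) \<phi>))"
    have "?P c d"
    proof (rule Bolzano[where P = ?P, OF le(2)])
      fix y1 y2 y3 assume trans: "?P y1 y2" "?P y2 y3" "y1 \<le> y2" "y2 \<le> y3"
      show "?P y1 y3"
      proof
        assume "c \<le> y1 \<and> y3 \<le> d"
        with trans(3,4) have "c \<le> y1 \<and> y2 \<le> d" "c \<le> y2 \<and> y3 \<le> d" by auto
        from mp[OF trans(1) this(1)] mp[OF trans(2) this(2)] obtain e1 e2 where e: "e1 > 0" "e2 > 0"
          "\<And>x1 x2. a \<le> x1 \<and> x1 \<le> x \<and> x \<le> x2 \<and> x2 \<le> b \<and> x2 - x1 < e1 \<longrightarrow>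
            (\<exists>\<phi>. primitive_along G f ({x1..x2} \<times> {y1..y2}) \<phi>)"
          "\<And>x1 x2. a \<le> x1 \<and> x1 \<le> x \<and> x \<le> x2 \<and> x2 \<le> b \<and> x2 - x1 < e2 \<longrightarrow>
            (\<exists>\<phi>. primitive_along G f ({x1..x2} \<times> {y2..y3}) \<phi>)"
          by blast
        show "\<exists>e>0. \<forall>x1 x2. a \<le> x1 \<and> x1 \<le> x \<and> x \<le> x2 \<and> x2 \<le> b \<and> x2 - x1 < e \<longrightarrow>
          (\<exists>\<phi>. primitive_along G f ({x1..x2} \<times> {y1..y3}) \<phi>)"
        proof (intro exI[of _ "min e1 e2"] conjI allI impI)
          fix x1 x2
          assume *: "a \<le> x1 \<and> x1 \<le> x \<and> x \<le> x2 \<and> x2 \<le> b \<and> x2 - x1 < min e1 e2"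
          show "\<exists>\<phi>. primitive_along G f ({x1..x2} \<times> {y1..y3}) \<phi>"
            using * by (intro glue1[OF _ _ trans(3,4)] e(3)[rule_format] e(4)[rule_format]) auto
        qed (use e in auto)
      qed
    next
      fix y assume local: "c \<le> y" "y \<le> d"
      obtain T where T: "open T" "(x, y) \<in> T"
        "primitive_along G f ({a..b} \<times> {c..d} \<inter> T) (\<lambda>t. G (f (x,y)) (f t))"
        using primitive_along_local[OF G f, of "(x,y)"] x local by auto
      obtain A B where AB: "open A" "open B" "x \<in> A" "y \<in> B" "A \<times> B \<subseteq> T"
        using T(1,2) by (rule open_prod_elim) auto
      obtain e1 where e1: "e1 > 0" "\<And>z. \<bar>z - x\<bar> < e1 \<Longrightarrow> z \<in> A"
        using AB(1,3) unfolding open_dist dist_real_def by metis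
      obtain e2 where e2: "e2 > 0" "\<And>z. \<bar>z - y\<bar> < e2 \<Longrightarrow> z \<in> B"
        using AB(2,4) unfolding open_dist dist_real_def by metis
      have "?P y1 y2" if y12: "y1 \<le> y" "y \<le> y2" "y2 - y1 < e2" for y1 y2
      proof (intro impI exI[of _ e1] conjI allI)
        fix x1 x2
        assume cd: "c \<le> y1 \<and> y2 \<le> d"
          and x12: "a \<le> x1 \<and> x1 \<le> x \<and> x \<le> x2 \<and> x2 \<le> b \<and> x2 - x1 < e1"
        have "{x1..x2} \<times> {y1..y2} \<subseteq> {a..b} \<times> {c..d} \<inter> T"
        proof
          fix z assume "z \<in> {x1..x2} \<times> {y1..y2}"
          then obtain u v where z: "z = (u,v)" and uv: "x1 \<le> u" "u \<le> x2" "y1 \<le> v" "v \<le> y2"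
            by auto
          have "u \<in> A" "v \<in> B" using uv x12 y12 by (auto intro!: e1 e2)
          with uv x12 cd AB(5) z show "z \<in> {a..b} \<times> {c..d} \<inter> T" by auto
        qed
        then show "\<exists>\<phi>. primitive_along G f ({x1..x2} \<times> {y1..y2}) \<phi>"
          using primitive_along_subset T(3) by blast
      qed (rule e1(1))
      then show "\<exists>e>0. \<forall>y1 y2. y1 \<le> y \<and> y \<le> y2 \<and> y2 - y1 < e \<longrightarrow> ?P y1 y2"
        by (intro exI[of _ e2]) (use e2(1) in auto)
    qed
    then show ?thesis by simp
  qed
  let ?Q = "\<lambda>x1 x2. a \<le> x1 \<and> x2 \<le> b \<longrightarrow> (\<exists>\<phi>. primitive_along G f ({x1..x2} \<times> {c..d}) \<phi>)"
  have "?Q a b"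
  proof (rule Bolzano[where P = ?Q, OF le(1)])
    fix x1 x2 x3 assume "?Q x1 x2" "?Q x2 x3" "x1 \<le> x2" "x2 \<le> x3"
    then show "?Q x1 x3" using glue2[of x1 x2 c d x3] by auto
  next
    fix x assume "a \<le> x" "x \<le> b"
    from strip[OF this] obtain e where e: "e > 0"
      "\<And>x1 x2. a \<le> x1 \<and> x1 \<le> x \<and> x \<le> x2 \<and> x2 \<le> b \<and> x2 - x1 < e \<Longrightarrow>
        (\<exists>\<phi>. primitive_along G f ({x1..x2} \<times> {c..d}) \<phi>)"
      by blast
    show "\<exists>e>0. \<forall>x1 x2. x1 \<le> x \<and> x \<le> x2 \<and> x2 - x1 < e \<longrightarrow> ?Q x1 x2"
      by (rule exI[of _ e]) (use e in auto)
  qed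
  then show thesis using that by auto
qed

text \<open>A path is a map of the square that ignores the second coordinate; restriction to a side
  recovers it.\<close>

lemma primitive_along_path:
  assumes "locally_additive G" "path g"
  obtains \<phi> where "primitive_along G g {0..1} \<phi>"
proof -
  have "continuous_on ({0..1} \<times> {0..1::real}) (g \<circ> fst)"
    using assms(2) unfolding path_def
    by (intro continuous_on_compose continuous_intros) (auto elim: continuous_on_subset)
  then obtain \<phi> where \<phi>: "primitive_along G (g \<circ> fst) ({0..1} \<times> {0..1::real}) \<phi>"
    using primitive_along_rectangle[OF assms(1)] by (metis zero_le_one)
  have "primitive_along G ((g \<circ> fst) \<circ> (\<lambda>u. (u, 0::real))) {0..1} (\<phi> \<circ> (\<lambda>u. (u, 0)))"
    by (rule primitive_along_compose[OF \<phi>]) (auto intro!: continuous_intros)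
  then show thesis using that by (simp add: comp_def)
qed

text \<open>The analogue of the integral of a closed one-form along \<open>g\<close>. The
  description is unambiguous by \<open>primitive_along_diff_const\<close>.\<close>

definition increment :: "('a::topological_space \<Rightarrow> 'a \<Rightarrow> real) \<Rightarrow> (real \<Rightarrow> 'a) \<Rightarrow> real" where
  "increment G g = (THE r. \<exists>\<phi>. primitive_along G g {0..1} \<phi> \<and> r = \<phi> 1 - \<phi> 0)"

lemma increment_eq:
  assumes "primitive_along G g {0..1} \<phi>"
  shows "increment G g = \<phi> 1 - \<phi> 0"
  unfolding increment_def
proof (rule the_equality)
  fix r assume "\<exists>\<psi>. primitive_along G g {0..1} \<psi> \<and> r = \<psi> 1 - \<psi> 0"
  then show "r = \<phi> 1 - \<phi> 0"
    using primitive_along_diff_const[OF _ assms, of _ 0 1] by fastforce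
qed (use assms in blast)

text \<open>One primitive on the whole square computes all four sides, so the signed sum around the
  boundary cancels. The side \<open>a = 0\<close> is constant and contributes nothing because
  \<open>G p p = 0\<close>.\<close>

lemma increment_square:
  fixes f :: "real \<times> real \<Rightarrow> 'a::topological_space"
  assumes "locally_additive G" "continuous_on ({0..1} \<times> {0..1}) f"
    and "\<And>b. b \<in> {0..1} \<Longrightarrow> f (0, b) = f (0, 0)"
  shows "increment G (\<lambda>b. f (1, b)) - increment G (\<lambda>a. f (a, 1)) + increment G (\<lambda>a. f (a, 0)) = 0"
proof -
  obtain \<phi> where \<phi>: "primitive_along G f ({0..1} \<times> {0..1}) \<phi>"
    using primitive_along_rectangle[OF assms(1,2)] by (metis zero_le_one)
  have h: "primitive_along G (\<lambda>b. f (c, b)) {0..1} (\<lambda>b. \<phi> (c, b))" if "c \<in> {0..1}" for c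
  proof -
    have "continuous_on {0..1} (\<lambda>b. (c, b))" by (intro continuous_intros)
    from primitive_along_compose[OF \<phi> this] show ?thesis
      using that by (auto simp: comp_def image_subset_iff)
  qed
  have v: "primitive_along G (\<lambda>a. f (a, c)) {0..1} (\<lambda>a. \<phi> (a, c))" if "c \<in> {0..1}" for c
  proof -
    have "continuous_on {0..1} (\<lambda>a. (a, c))" by (intro continuous_intros)
    from primitive_along_compose[OF \<phi> this] show ?thesis
      using that by (auto simp: comp_def image_subset_iff)
  qed
  have "primitive_along G (\<lambda>b::real. f (0, 0)) {0..1} (\<lambda>b. 0)"
    using locally_additive_self[OF assms(1)] unfolding primitive_along_def by simp
  then have "primitive_along G (\<lambda>b. f (0, b)) {0..1} (\<lambda>b. 0)"
    by (rule primitive_along_cong) (use assms(3) in metis)+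
  then have "\<phi> (0, 1) = \<phi> (0, 0)"
    using increment_eq[OF h[of 0]] increment_eq[of G "\<lambda>b. f (0,b)" "\<lambda>_. 0"] by simp
  moreover have "increment G (\<lambda>b. f (1, b)) = \<phi> (1,1) - \<phi> (1,0)"
    "increment G (\<lambda>a. f (a, 1)) = \<phi> (1,1) - \<phi> (0,1)"
    "increment G (\<lambda>a. f (a, 0)) = \<phi> (1,0) - \<phi> (0,0)"
    using increment_eq[OF h[of 1]] increment_eq[OF v[of 1]] increment_eq[OF v[of 0]] by simp_all
  ultimately show ?thesis by simp
qed

section \<open>Increments and singular homology\<close>

lemma increment_cong:
  assumes "\<And>u. u \<in> {0..1} \<Longrightarrow> g u = h u"
  shows "increment G g = increment G h"
proof -
  have "primitive_along G g {0..1} \<phi> \<longleftrightarrow> primitive_along G h {0..1} \<phi>" for \<phi>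
    using primitive_along_cong[of G g "{0..1}" \<phi> h \<phi>] primitive_along_cong[of G h "{0..1}" \<phi> g \<phi>]
      assms by metis
  then show ?thesis unfolding increment_def by simp
qed

section \<open>Additive extension of increments to singular chains\<close>

definition frag_value :: "('b \<Rightarrow> real) \<Rightarrow> ('b \<Rightarrow>\<^sub>0 int) \<Rightarrow> real" where
  "frag_value I c = (\<Sum>\<sigma>\<in>Poly_Mapping.keys c. of_int (Poly_Mapping.lookup c \<sigma>) * I \<sigma>)"

lemma frag_value_superset:
  assumes "finite S" "Poly_Mapping.keys c \<subseteq> S"
  shows "frag_value I c = (\<Sum>\<sigma>\<in>S. of_int (Poly_Mapping.lookup c \<sigma>) * I \<sigma>)"
  unfolding frag_value_def
  by (rule sum.mono_neutral_left) (use assms in \<open>auto simp: in_keys_iff\<close>)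

lemma frag_value_add: "frag_value I (a + b) = frag_value I a + frag_value I b"
proof -
  let ?S = "Poly_Mapping.keys a \<union> Poly_Mapping.keys b"
  have "Poly_Mapping.keys (a + b) \<subseteq> ?S" by (rule Poly_Mapping.keys_add)
  then show ?thesis
    by (simp add: frag_value_superset[of ?S] lookup_add algebra_simps sum.distrib)
qed

lemma frag_value_zero [simp]: "frag_value I 0 = 0"
  by (simp add: frag_value_def)

lemma frag_value_minus: "frag_value I (- a) = - frag_value I a"
  using frag_value_add[of I a "- a"] by simp

lemma frag_value_diff: "frag_value I (a - b) = frag_value I a - frag_value I b"
  using frag_value_add[of I a "- b"] by (simp add: frag_value_minus)

lemma frag_value_of [simp]: "frag_value I (frag_of x) = I x"
  by (simp add: frag_value_def)

lemma frag_value_sum: "frag_value I (\<Sum>i\<in>A. c i) = (\<Sum>i\<in>A. frag_value I (c i))"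
  by (induction A rule: infinite_finite_induct) (simp_all add: frag_value_add)

text \<open>Matches the convention of \<open>curve_simplex\<close>, so that composing the two gives
  back the path on \<open>{0..1}\<close>.\<close>

definition edge_point :: "real \<Rightarrow> nat \<Rightarrow> real" where
  "edge_point u = (\<lambda>i. if i = 0 then 1 - u else if i = 1 then u else 0)"

lemma edge_point_in_simplex: "u \<in> {0..1} \<Longrightarrow> edge_point u \<in> standard_simplex 1"
  by (auto simp: standard_simplex_def edge_point_def)

text \<open>The square is collapsed onto the triangle by contracting the side \<open>a = 0\<close> to a vertex.\<close>

definition triangle_point :: "real \<times> real \<Rightarrow> nat \<Rightarrow> real" where
  "triangle_point = (\<lambda>(a, b) i.
     if i = 0 then 1 - a else if i = 1 then a * (1 - b) else if i = 2 then a * b else 0)"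

lemma continuous_map_triangle_point:
  "continuous_map (top_of_set ({0..1} \<times> {0..1}))
     (subtopology (powertop_real UNIV) (standard_simplex 2)) triangle_point"
proof (rule continuous_map_into_subtopology)
  show "continuous_map (top_of_set ({0..1} \<times> {0..1})) (powertop_real UNIV) triangle_point"
    unfolding continuous_map_componentwise_UNIV
  proof
    fix k :: nat
    consider "k = 0" | "k = 1" | "k = 2" | "k > 2" by linarith
    then show "continuous_map (top_of_set ({0..1} \<times> {0..1})) euclideanreal (\<lambda>x. triangle_point x k)"
      by cases (auto simp: triangle_point_def case_prod_beta intro!: continuous_intros)
  qed
  show "triangle_point \<in> topspace (top_of_set ({0..1} \<times> {0..1})) \<rightarrow> standard_simplex 2"
  proof (clarsimp simp: standard_simplex_def)
    fix a b :: real assume *: "0 \<le> a" "a \<le> 1" "0 \<le> b" "b \<le> 1"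
    have "a * (1 - b) \<le> 1 * 1" "a * b \<le> 1 * 1" "a * b \<le> a * 1"
      using * by (intro mult_mono; simp)+
    then show "(\<forall>i. 0 \<le> triangle_point (a, b) i \<and> triangle_point (a, b) i \<le> 1) \<and>
        (\<forall>i>2. triangle_point (a, b) i = 0) \<and> sum (triangle_point (a, b)) {..2} = 1"
      using * by (auto simp: triangle_point_def numeral_2_eq_2 algebra_simps)
  qed
qed

text \<open>The three sides of the square that survive the collapse are the faces:
  \<open>(1, b)\<close> runs along face 0, \<open>(a, 1)\<close> along face 1 and
  \<open>(a, 0)\<close> along face 2. The signs in \<open>increment_square\<close> are those of the
  simplicial boundary.\<close>

lemma increment_boundary:
  fixes f :: "(nat \<Rightarrow> real) \<Rightarrow> 'a::topological_space"
  assumes G: "locally_additive G" and f: "singular_simplex 2 euclidean f"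
  shows "frag_value (\<lambda>\<sigma>. increment G (\<sigma> \<circ> edge_point)) (chain_boundary 2 (frag_of f)) = 0"
proof -
  let ?I = "\<lambda>k. increment G (singular_face 2 k f \<circ> edge_point)"
  have "continuous_map (top_of_set ({0..1} \<times> {0..1})) euclidean (f \<circ> triangle_point)"
    using continuous_map_triangle_point f unfolding singular_simplex_def
    by (blast intro: continuous_map_compose)
  then have "continuous_on ({0..1} \<times> {0..1}) (f \<circ> triangle_point)" by simp
  moreover have "(f \<circ> triangle_point) (0, b) = (f \<circ> triangle_point) (0, 0)" for b
    by (auto simp: triangle_point_def intro!: arg_cong[of _ _ f])
  ultimately have "increment G (\<lambda>b. (f \<circ> triangle_point) (1, b)) -
      increment G (\<lambda>a. (f \<circ> triangle_point) (a, 1)) +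
      increment G (\<lambda>a. (f \<circ> triangle_point) (a, 0)) = 0"
    by (intro increment_square[OF G]) auto
  moreover have "increment G (\<lambda>b. (f \<circ> triangle_point) (1, b)) = ?I 0"
    using edge_point_in_simplex
    by (intro increment_cong)
      (auto simp: singular_face_def simplical_face_def triangle_point_def edge_point_def fun_eq_iff intro!: arg_cong[of _ _ f])
  moreover have "increment G (\<lambda>b. (f \<circ> triangle_point) (b, 1)) = ?I 1"
    using edge_point_in_simplex
    by (intro increment_cong)
      (auto simp: singular_face_def simplical_face_def triangle_point_def edge_point_def fun_eq_iff intro!: arg_cong[of _ _ f])
  moreover have "increment G (\<lambda>b. (f \<circ> triangle_point) (b, 0)) = ?I 2"
    using edge_point_in_simplex
    by (intro increment_cong)
      (auto simp: singular_face_def simplical_face_def triangle_point_def edge_point_def fun_eq_iff intro!: arg_cong[of _ _ f])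
  ultimately have "?I 0 - ?I 1 + ?I 2 = 0" by simp
  moreover have "chain_boundary 2 (frag_of f) =
      frag_of (singular_face 2 0 f) - frag_of (singular_face 2 1 f) + frag_of (singular_face 2 2 f)"
    by (simp add: chain_boundary_of numeral_2_eq_2)
  ultimately show ?thesis
    by (simp add: frag_value_add frag_value_diff)
qed

text \<open>The sum is the boundary of a 2-chain \<open>d\<close>, and additivity in
  \<open>d\<close> reduces the claim to a single simplex.\<close>

theorem sum_increment_null_homologous:
  fixes \<gamma> :: "'i \<Rightarrow> real \<Rightarrow> 'a::topological_space"
  assumes G: "locally_additive G"
    and hom: "homologous_rel 1 euclidean {} (\<Sum>i\<in>I. frag_of (curve_simplex (\<gamma> i))) 0"
  shows "(\<Sum>i\<in>I. increment G (\<gamma> i)) = 0"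
proof -
  let ?V = "frag_value (\<lambda>\<sigma>. increment G (\<sigma> \<circ> edge_point))"
  obtain d where d: "singular_chain 2 euclidean d"
    "chain_boundary 2 d = (\<Sum>i\<in>I. frag_of (curve_simplex (\<gamma> i)))"
    using hom by (auto simp: homologous_rel_def singular_boundary numeral_2_eq_2)
  have "?V (chain_boundary 2 d) = 0"
    using d(1) unfolding singular_chain_def
    by (induction rule: frag_induction)
      (auto simp: chain_boundary_diff frag_value_diff increment_boundary[OF G, unfolded comp_def] comp_def)
  moreover have "increment G (curve_simplex (\<gamma> i) \<circ> edge_point) = increment G (\<gamma> i)" for i
    using edge_point_in_simplex
    by (intro increment_cong) (auto simp: curve_simplex_def edge_point_def)
  ultimately show ?thesis
    using d(2) by (simp add: frag_value_sum)
qed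

section \<open>Flat patches\<close>

text \<open>A primitive \<open>H\<close> of \<open>f\<close> with \<open>H u = 0\<close> vanishes at
  \<open>u\<close> to a finite order \<open>n\<close>, so it is the \<open>n\<close>-th power of a
  local coordinate \<open>W\<close>, and \<open>\<kappa>\<close> inverts \<open>W\<close>. The last
  clause says that \<open>\<kappa>\<close> pulls \<open>f(z) dz\<close> back to
  \<open>d(w ^ n)\<close>; the zero of \<open>f\<close> has order \<open>n - 1\<close>.\<close>

lemma holomorphic_form_normal_form:
  assumes f: "f holomorphic_on S" "open S" "u \<in> S" and nz: "\<exists>\<^sub>F z in nhds u. f z \<noteq> 0"
  obtains n \<rho> \<kappa> where "0 < n" "0 < \<rho>" "\<kappa> holomorphic_on ball 0 \<rho>" "inj_on \<kappa> (ball 0 \<rho>)"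
    "\<kappa> ` ball 0 \<rho> \<subseteq> S" "\<kappa> 0 = u"
    "\<And>w. w \<in> ball 0 \<rho> \<Longrightarrow> f (\<kappa> w) * deriv \<kappa> w = of_nat n * w ^ (n - 1)"
proof -
  obtain r0 where r0: "r0 > 0" "ball u r0 \<subseteq> S"
    using f(2,3) openE by blast
  have f0: "f holomorphic_on ball u r0" using f(1) r0(2) holomorphic_on_subset by blast
  obtain H0 where H0: "\<And>z. z \<in> ball u r0 \<Longrightarrow> (H0 has_field_derivative f z) (at z)"
    using holomorphic_convex_primitive'[OF convex_ball open_ball f0]
    by (metis at_within_open open_ball)
  define H where "H = (\<lambda>z. H0 z - H0 u)"
  have H: "(H has_field_derivative f z) (at z)" if "z \<in> ball u r0" for z
    unfolding H_def using H0[OF that] by (auto intro!: derivative_eq_intros)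
  have holH: "H holomorphic_on ball u r0"
    using H by (meson field_differentiable_at_within field_differentiable_def holomorphic_onI)
  \<comment> \<open>Otherwise \<open>H\<close> would be constant and \<open>f\<close> would vanish
    near \<open>u\<close>, against \<open>nz\<close>.\<close>
  have "\<exists>n>0. (deriv ^^ n) H u \<noteq> 0"
  proof (rule ccontr)
    assume "\<not> ?thesis"
    have const: "H z = H u" if "z \<in> ball u r0" for z
    proof (rule holomorphic_fun_eq_const_on_connected[OF holH open_ball connected_ball _ _ that])
      show "(deriv ^^ n) H u = 0" if "0 < n" for n
        using \<open>\<not> (\<exists>n>0. (deriv ^^ n) H u \<noteq> 0)\<close> that by blast
    qed (use r0(1) in simp)
    have "f z = 0" if "z \<in> ball u r0" for z
    proof -
      have "((\<lambda>_. H u) has_field_derivative f z) (at z)"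
        by (rule has_field_derivative_transform_within_open[OF H[OF that] open_ball that]) 
          (use const in auto)
      then show ?thesis by (metis DERIV_const DERIV_unique)
    qed
    then have "\<forall>\<^sub>F z in nhds u. f z = 0"
      using r0(1) eventually_nhds_in_open[OF open_ball, of u u r0] by (auto elim: eventually_mono)
    with nz show False by (simp add: frequently_def)
  qed
  moreover have uin: "u \<in> ball u r0" using r0(1) by simp
  ultimately obtain n where n: "0 < n" "(deriv ^^ n) H u \<noteq> 0"
    "\<And>i. 0 < i \<Longrightarrow> i < n \<Longrightarrow> (deriv ^^ i) H u = 0"
    unfolding exists_least_iff[of "\<lambda>n. n > 0 \<and> (deriv ^^ n) H u \<noteq> 0"] by blast
  obtain g r where g: "0 < r" "g holomorphic_on ball u r"
    "\<And>w. w \<in> ball u r \<Longrightarrow> H w - H u = ((w - u) * g w) ^ n"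
    "\<And>w. w \<in> ball u r \<Longrightarrow> g w \<noteq> 0"
    by (rule holomorphic_factor_order_of_zero_strong[OF holH open_ball uin n(1,2)])
      (rule n(3), assumption, assumption, rule that)
  define W where "W = (\<lambda>z. (z - u) * g z)"
  let ?r = "min r r0"
  have u: "u \<in> ball u ?r" using g(1) r0(1) by simp
  have g': "g holomorphic_on ball u ?r"
    using g(2) by (rule holomorphic_on_subset) auto
  have holW: "W holomorphic_on ball u ?r"
    unfolding W_def by (intro holomorphic_intros g')
  have "(g has_field_derivative deriv g u) (at u)"
    using g' u holomorphic_derivI open_ball by blast
  \<comment> \<open>The factor \<open>z - u\<close> vanishes at \<open>u\<close>, so only
    \<open>g u\<close> survives; it is nonzero, which makes \<open>W\<close> locally
    invertible.\<close>
  then have "(W has_field_derivative g u) (at u)"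
    unfolding W_def by (auto intro!: derivative_eq_intros)
  then have "deriv W u \<noteq> 0"
    using g(1,4) DERIV_imp_deriv by fastforce
  then obtain r1 where r1: "r1 > 0" "ball u r1 \<subseteq> ball u ?r" "open (W ` ball u r1)"
    "inj_on W (ball u r1)"
    using has_complex_derivative_locally_invertible[OF holW u open_ball] by blast
  have holW1: "W holomorphic_on ball u r1"
    using holW r1(2) holomorphic_on_subset by blast
  obtain \<kappa> where \<kappa>: "\<kappa> holomorphic_on W ` ball u r1" "\<And>z. z \<in> ball u r1 \<Longrightarrow> \<kappa> (W z) = z"
    using holomorphic_has_inverse[OF holW1 open_ball r1(4)] by metis
  have "W u = 0" by (simp add: W_def)
  then have "0 \<in> W ` ball u r1" using r1(1) by (metis centre_in_ball imageI)
  then obtain \<rho> where \<rho>: "\<rho> > 0" "ball 0 \<rho> \<subseteq> W ` ball u r1"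
    using r1(3) openE by blast
  have in_ball: "\<kappa> w \<in> ball u r1" and inv: "W (\<kappa> w) = w" if "w \<in> ball 0 \<rho>" for w
    using \<rho>(2) that \<kappa>(2) by auto
  have hol\<kappa>: "\<kappa> holomorphic_on ball 0 \<rho>" using \<kappa>(1) \<rho>(2) holomorphic_on_subset by blast
  show thesis
  proof (rule that[OF n(1) \<rho>(1) hol\<kappa>])
    show "inj_on \<kappa> (ball 0 \<rho>)" using inv by (metis inj_onI)
    show "\<kappa> ` ball 0 \<rho> \<subseteq> S" using in_ball r1(2) r0(2) by fastforce
    show "\<kappa> 0 = u" using \<kappa>(2)[of u] r1(1) \<open>W u = 0\<close> by simp
  next
    fix w :: complex assume w: "w \<in> ball 0 \<rho>"
    have "H (\<kappa> v) - H u = v ^ n" if "v \<in> ball 0 \<rho>" for v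
      using g(3)[of "\<kappa> v"] in_ball[OF that] inv[OF that] r1(2) by (auto simp: W_def)
    then have eq: "H (\<kappa> v) = v ^ n + H u" if "v \<in> ball 0 \<rho>" for v
      using that by (simp add: diff_eq_eq)
    have "(\<kappa> has_field_derivative deriv \<kappa> w) (at w)"
      using hol\<kappa> w holomorphic_derivI open_ball by blast
    moreover have "(H has_field_derivative f (\<kappa> w)) (at (\<kappa> w))"
      using H in_ball[OF w] r1(2) by auto
    ultimately have "((\<lambda>v. H (\<kappa> v)) has_field_derivative f (\<kappa> w) * deriv \<kappa> w) (at w)"
      by (rule DERIV_chain2[rotated])
    then have "((\<lambda>v. v ^ n + H u) has_field_derivative f (\<kappa> w) * deriv \<kappa> w) (at w)"
      by (rule has_field_derivative_transform_within_open[OF _ open_ball w]) (use eq in auto)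
    moreover have "((\<lambda>v. v ^ n + H u) has_field_derivative of_nat n * w ^ (n - 1)) (at w)"
      by (auto intro!: derivative_eq_intros)
    ultimately show "f (\<kappa> w) * deriv \<kappa> w = of_nat n * w ^ (n - 1)"
      by (rule DERIV_unique)
  qed
qed

section \<open>Charts of the surface and flat coordinates\<close>

locale holomorphic_form =
  fixes A :: "'a::t2_space chart set" and \<omega> :: "'a form"
  assumes atlas: "complex_atlas A" and form: "holomorphic_one_form A \<omega>"
begin

abbreviation chart_inv :: "'a chart \<Rightarrow> complex \<Rightarrow> 'a" where
  "chart_inv c \<equiv> inv_into (fst c) (snd c)"

lemma chart:
  assumes "c \<in> A"
  shows chart_open: "open (fst c)" and chart_image_open: "open (snd c ` fst c)"
    and chart_homeomorphism: "homeomorphism (fst c) (snd c ` fst c) (snd c) (chart_inv c)"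
  using atlas assms unfolding complex_atlas_def by auto

lemma chart_inv [simp]:
  assumes "c \<in> A"
  shows "p \<in> fst c \<Longrightarrow> chart_inv c (snd c p) = p"
    and "z \<in> snd c ` fst c \<Longrightarrow> snd c (chart_inv c z) = z"
    and "z \<in> snd c ` fst c \<Longrightarrow> chart_inv c z \<in> fst c"
  using chart_homeomorphism[OF assms] unfolding homeomorphism_def by (blast, blast, blast)

lemma chart_image_open_subset:
  assumes "c \<in> A" "open U" "U \<subseteq> fst c"
  shows "open (snd c ` U)"
  using homeomorphism_imp_open_map[OF chart_homeomorphism[OF assms(1)], of U] assms chart[OF assms(1)]
  by (simp add: openin_open_eq)

lemma chart_inv_image_open:
  assumes "c \<in> A" "open U" "U \<subseteq> snd c ` fst c"
  shows "open (chart_inv c ` U)"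
  using homeomorphism_imp_open_map[OF homeomorphism_symD[OF chart_homeomorphism[OF assms(1)]], of U]
    assms chart[OF assms(1)]
  by (simp add: openin_open_eq)

lemma transition_derivative:
  assumes "c \<in> A" "d \<in> A" "p \<in> fst c" "p \<in> fst d"
  obtains D where "((snd d \<circ> chart_inv c) has_field_derivative D) (at (snd c p))"
    "\<omega> c (snd c p) = \<omega> d (snd d p) * D"
proof (rule that)
  have "open (snd c ` (fst c \<inter> fst d))"
    using assms by (intro chart_image_open_subset chart_open open_Int) auto
  moreover have "(snd d \<circ> chart_inv c) holomorphic_on snd c ` (fst c \<inter> fst d)"
    using atlas assms unfolding complex_atlas_def by blast
  ultimately show "((snd d \<circ> chart_inv c) has_field_derivative deriv (snd d \<circ> chart_inv c) (snd c p)) (at (snd c p))"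
    using assms by (intro holomorphic_derivI) auto
  show "\<omega> c (snd c p) = \<omega> d (snd d p) * deriv (snd d \<circ> chart_inv c) (snd c p)"
    using form assms unfolding holomorphic_one_form_def by blast
qed

lemma form_zeros_chart:
  assumes "c \<in> A" "p \<in> fst c"
  shows "p \<in> form_zeros A \<omega> \<longleftrightarrow> \<omega> c (snd c p) = 0"
proof
  assume "p \<in> form_zeros A \<omega>"
  then obtain d where "d \<in> A" "p \<in> fst d" "\<omega> d (snd d p) = 0"
    unfolding form_zeros_def by blast
  then show "\<omega> c (snd c p) = 0"
    using transition_derivative[OF assms(1) \<open>d \<in> A\<close> assms(2)] by (metis mult_zero_left)
qed (use assms in \<open>auto simp: form_zeros_def\<close>)

lemma coefficient_holomorphic: "c \<in> A \<Longrightarrow> \<omega> c holomorphic_on snd c ` fst c"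
  using form unfolding holomorphic_one_form_def by blast

lemma chart_covers: obtains c where "c \<in> A" "p \<in> fst c"
  using atlas unfolding complex_atlas_def by blast

text \<open>A flat patch is the inverse of a local coordinate in which the form is \<open>dz\<close>; the latter is
  expressed in a chart \<open>c\<close> as \<open>k\<^sup>* (\<omega> c u du) = dz\<close>.\<close>

definition flat_patch :: "complex set \<Rightarrow> (complex \<Rightarrow> 'a) \<Rightarrow> bool" where
  "flat_patch C \<psi> \<longleftrightarrow> open C \<and> convex C \<and>
     (\<exists>c\<in>A. \<exists>k. k holomorphic_on C \<and> inj_on k C \<and> k ` C \<subseteq> snd c ` fst c \<and>
        (\<forall>z\<in>C. \<omega> c (k z) * deriv k z = 1) \<and> (\<forall>z\<in>C. \<psi> z = chart_inv c (k z)))"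

lemma flat_patch_open: "flat_patch C \<psi> \<Longrightarrow> open C"
  and flat_patch_convex: "flat_patch C \<psi> \<Longrightarrow> convex C"
  unfolding flat_patch_def by auto

lemma flat_patch_chart:
  assumes "flat_patch C \<psi>"
  obtains c k where "c \<in> A" "k holomorphic_on C" "inj_on k C" "k ` C \<subseteq> snd c ` fst c"
    "\<And>z. z \<in> C \<Longrightarrow> \<omega> c (k z) * deriv k z = 1"
    "\<And>z. z \<in> C \<Longrightarrow> \<psi> z = chart_inv c (k z)"
    "\<And>z. z \<in> C \<Longrightarrow> \<psi> z \<in> fst c" "\<And>z. z \<in> C \<Longrightarrow> snd c (\<psi> z) = k z"
proof -
  obtain c k where "c \<in> A" "k holomorphic_on C" "inj_on k C" "k ` C \<subseteq> snd c ` fst c"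
    "\<forall>z\<in>C. \<omega> c (k z) * deriv k z = 1" "\<forall>z\<in>C. \<psi> z = chart_inv c (k z)"
    using assms unfolding flat_patch_def by blast
  then show thesis
    using chart_inv(2,3)[OF \<open>c \<in> A\<close>] by (intro that[of c k]) (auto simp: image_subset_iff)
qed

lemma flat_patch_inj:
  assumes "flat_patch C \<psi>"
  shows "inj_on \<psi> C"
  using assms by (elim flat_patch_chart) (metis inj_on_def)

lemma flat_patch_continuous:
  assumes "flat_patch C \<psi>"
  shows "continuous_on C \<psi>"
proof -
  obtain c k where ck: "c \<in> A" "k holomorphic_on C" "inj_on k C" "k ` C \<subseteq> snd c ` fst c"
    "\<And>z. z \<in> C \<Longrightarrow> \<omega> c (k z) * deriv k z = 1"
    "\<And>z. z \<in> C \<Longrightarrow> \<psi> z = chart_inv c (k z)"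
    "\<And>z. z \<in> C \<Longrightarrow> \<psi> z \<in> fst c" "\<And>z. z \<in> C \<Longrightarrow> snd c (\<psi> z) = k z"
    by (rule flat_patch_chart[OF assms]) (rule that)
  have "continuous_on C (chart_inv c \<circ> k)"
    using chart_homeomorphism[OF ck(1)] ck(2,4) unfolding homeomorphism_def
    by (intro continuous_on_compose holomorphic_on_imp_continuous_on) (auto elim: continuous_on_subset)
  then show ?thesis using ck(6) by (simp cong: continuous_on_cong)
qed

lemma flat_patch_image_open:
  assumes "flat_patch C \<psi>" "open U" "U \<subseteq> C"
  shows "open (\<psi> ` U)"
proof -
  obtain c k where ck: "c \<in> A" "k holomorphic_on C" "inj_on k C" "k ` C \<subseteq> snd c ` fst c"
    "\<And>z. z \<in> C \<Longrightarrow> \<omega> c (k z) * deriv k z = 1"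
    "\<And>z. z \<in> C \<Longrightarrow> \<psi> z = chart_inv c (k z)"
    "\<And>z. z \<in> C \<Longrightarrow> \<psi> z \<in> fst c" "\<And>z. z \<in> C \<Longrightarrow> snd c (\<psi> z) = k z"
    by (rule flat_patch_chart[OF assms(1)]) (rule that)
  have "open (k ` U)"
    using ck(2,3) assms(2,3) by (meson holomorphic_on_subset inj_on_subset open_mapping_thm3)
  then have "open (chart_inv c ` (k ` U))"
    using ck(4) assms(3) by (intro chart_inv_image_open[OF ck(1)]) auto
  moreover have "\<psi> ` U = chart_inv c ` (k ` U)"
    using ck(6) assms(3) by (force simp: image_image)
  ultimately show ?thesis by simp
qed

lemma flat_patch_regular:
  assumes "flat_patch C \<psi>" "z \<in> C"
  shows "\<psi> z \<notin> form_zeros A \<omega>"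
proof -
  obtain c k where ck: "c \<in> A" "k holomorphic_on C" "inj_on k C" "k ` C \<subseteq> snd c ` fst c"
    "\<And>z. z \<in> C \<Longrightarrow> \<omega> c (k z) * deriv k z = 1"
    "\<And>z. z \<in> C \<Longrightarrow> \<psi> z = chart_inv c (k z)"
    "\<And>z. z \<in> C \<Longrightarrow> \<psi> z \<in> fst c" "\<And>z. z \<in> C \<Longrightarrow> snd c (\<psi> z) = k z"
    by (rule flat_patch_chart[OF assms(1)]) (rule that)
  from ck(5,7,8)[OF assms(2)] show ?thesis using form_zeros_chart[OF ck(1), of "\<psi> z"] by auto
qed

text \<open>\<open>flow_line\<close> imposes its equation in every chart around the point, so the
  identity \<open>\<omega> = dz\<close> has to be carried by the transformation law from the chart
  of the patch to an arbitrary chart \<open>d\<close>.\<close>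

lemma flat_patch_derivative:
  assumes "flat_patch C \<psi>" "z \<in> C" "d \<in> A" "\<psi> z \<in> fst d"
  obtains D where "((snd d \<circ> \<psi>) has_field_derivative D) (at z)" "\<omega> d (snd d (\<psi> z)) * D = 1"
proof -
  obtain c k where ck: "c \<in> A" "k holomorphic_on C" "inj_on k C" "k ` C \<subseteq> snd c ` fst c"
    "\<And>z. z \<in> C \<Longrightarrow> \<omega> c (k z) * deriv k z = 1"
    "\<And>z. z \<in> C \<Longrightarrow> \<psi> z = chart_inv c (k z)"
    "\<And>z. z \<in> C \<Longrightarrow> \<psi> z \<in> fst c" "\<And>z. z \<in> C \<Longrightarrow> snd c (\<psi> z) = k z"
    by (rule flat_patch_chart[OF assms(1)]) (rule that)
  obtain D where D: "((snd d \<circ> chart_inv c) has_field_derivative D) (at (k z))"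
    "\<omega> c (k z) = \<omega> d (snd d (\<psi> z)) * D"
    using transition_derivative[OF ck(1) assms(3) ck(7)[OF assms(2)] assms(4)] ck(8)[OF assms(2)] by metis
  have "(k has_field_derivative deriv k z) (at z)"
    using ck(2) assms(2) flat_patch_open[OF assms(1)] holomorphic_derivI by blast
  with D(1) have "((\<lambda>z. (snd d \<circ> chart_inv c) (k z)) has_field_derivative D * deriv k z) (at z)"
    by (rule DERIV_chain2)
  then have "((snd d \<circ> \<psi>) has_field_derivative D * deriv k z) (at z)"
    by (rule has_field_derivative_transform_within_open[OF _ flat_patch_open[OF assms(1)] assms(2)])
      (simp add: ck(6))
  moreover have "\<omega> d (snd d (\<psi> z)) * (D * deriv k z) = 1"
    using D(2) ck(5)[OF assms(2)] by (simp add: mult.assoc)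
  ultimately show thesis using that by blast
qed

lemma flat_patch_segment:
  assumes "flat_patch C \<psi>" "z \<in> C" "z + of_real t * v \<in> C" "s \<in> closed_segment 0 t"
  shows "z + of_real s * v \<in> C"
proof -
  obtain u where u: "0 \<le> u" "u \<le> 1" "s = u * t"
    using assms(4) by (auto simp: closed_segment_def)
  have "(1 - u) *\<^sub>R z + u *\<^sub>R (z + of_real t * v) \<in> C"
    using flat_patch_convex[OF assms(1)] assms(2,3) u by (intro convexD) auto
  then show ?thesis by (simp add: u(3) algebra_simps scaleR_conv_of_real)
qed

text \<open>In a flat coordinate the vector field on which the form equals \<open>v\<close> is the
  constant field \<open>v\<close>, so its orbits are straight; convexity keeps the segment inside
  the patch.\<close>

lemma flat_patch_flow_line:
  assumes "flat_patch C \<psi>" "z \<in> C" "z + of_real t * v \<in> C"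
  shows "flow_line A \<omega> v t (\<psi> z) (\<lambda>s. \<psi> (z + of_real s * v))"
  unfolding flow_line_def
proof (intro conjI ballI impI)
  note seg = flat_patch_segment[OF assms]
  show "\<psi> (z + of_real 0 * v) = \<psi> z" by simp
  show "continuous_on (closed_segment 0 t) (\<lambda>s. \<psi> (z + of_real s * v))"
    using seg by (intro continuous_on_compose2[OF flat_patch_continuous[OF assms(1)]] continuous_intros) auto
  fix s assume s: "s \<in> closed_segment 0 t"
  show "\<psi> (z + of_real s * v) \<notin> form_zeros A \<omega>"
    using flat_patch_regular[OF assms(1)] seg[OF s] by blast
  fix c assume "c \<in> A" "\<psi> (z + of_real s * v) \<in> fst c"
  then obtain D where D: "((snd c \<circ> \<psi>) has_field_derivative D) (at (z + of_real s * v))"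
    "\<omega> c (snd c (\<psi> (z + of_real s * v))) * D = 1"
    using flat_patch_derivative[OF assms(1) seg[OF s]] by blast
  have "((\<lambda>s. z + of_real s * v) has_vector_derivative v) (at s within closed_segment 0 t)"
    by (auto intro!: derivative_eq_intros simp: has_vector_derivative_def scaleR_conv_of_real)
  then have "((snd c \<circ> \<psi> \<circ> (\<lambda>s. z + of_real s * v)) has_vector_derivative v * D)
      (at s within closed_segment 0 t)"
    using D(1) by (rule field_vector_diff_chain_within[OF _ DERIV_subset]) auto
  then show "\<exists>w. ((snd c \<circ> (\<lambda>s. \<psi> (z + of_real s * v))) has_vector_derivative w)
        (at s within closed_segment 0 t) \<and> \<omega> c (snd c (\<psi> (z + of_real s * v))) * w = v"
    using D(2) by (intro exI[of _ "v * D"]) (simp add: comp_def algebra_simps)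
qed

text \<open>Conversely, a flow line read in the flat coordinate has constant velocity
  \<open>v\<close>. The claim is local in time because \<open>g\<close> may leave the patch and
  return.\<close>

lemma flow_line_flat_patch:
  assumes P: "flat_patch C \<psi>" and g: "flow_line A \<omega> v t x g"
    and s0: "s0 \<in> closed_segment 0 t" "g s0 = \<psi> z0" "z0 \<in> C"
  shows "\<forall>\<^sub>F s in nhds s0. z0 + of_real (s - s0) * v \<in> C \<and>
           (s \<in> closed_segment 0 t \<longrightarrow> g s = \<psi> (z0 + of_real (s - s0) * v))"
proof -
  obtain c k where ck: "c \<in> A" "k holomorphic_on C" "inj_on k C" "k ` C \<subseteq> snd c ` fst c"
    "\<And>z. z \<in> C \<Longrightarrow> \<omega> c (k z) * deriv k z = 1"
    "\<And>z. z \<in> C \<Longrightarrow> \<psi> z = chart_inv c (k z)"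
    "\<And>z. z \<in> C \<Longrightarrow> \<psi> z \<in> fst c" "\<And>z. z \<in> C \<Longrightarrow> snd c (\<psi> z) = k z"
    by (rule flat_patch_chart[OF P]) (rule that)
  note C = flat_patch_open[OF P]
  obtain h where h: "h holomorphic_on k ` C" "\<And>z. z \<in> C \<Longrightarrow> deriv k z * deriv h (k z) = 1"
    "\<And>z. z \<in> C \<Longrightarrow> h (k z) = z"
    using holomorphic_has_inverse[OF ck(2) C ck(3)] by metis
  have open_image: "open (k ` C)" using open_mapping_thm3[OF ck(2) C ck(3)] .
  have "continuous_on (closed_segment 0 t) g" using g unfolding flow_line_def by blast
  moreover have "open (\<psi> ` C)" "g s0 \<in> \<psi> ` C"
    using flat_patch_image_open[OF P C] s0 by auto
  ultimately obtain U where U: "open U" "s0 \<in> U" "\<And>s. s \<in> closed_segment 0 t \<Longrightarrow> s \<in> U \<Longrightarrow> g s \<in> \<psi> ` C"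
    using s0(1) unfolding continuous_on_topological by metis
  obtain \<delta> where \<delta>: "\<delta> > 0" "ball s0 \<delta> \<subseteq> U" using U(1,2) openE by blast
  define J where "J = closed_segment 0 t \<inter> ball s0 \<delta>"
  have J: "convex J" "s0 \<in> J" using s0(1) \<delta>(1) unfolding J_def by (auto intro!: convex_Int)
  define \<zeta> where "\<zeta> = (\<lambda>s. h (snd c (g s)))"
  have gJ: "\<zeta> s \<in> C" "g s = \<psi> (\<zeta> s)" "k (\<zeta> s) = snd c (g s)" if s: "s \<in> J" for s
  proof -
    have "s \<in> U" using \<delta>(2) s unfolding J_def by blast
    then have "g s \<in> \<psi> ` C"
      using U(3) s unfolding J_def by blast
    then obtain z where z: "z \<in> C" "g s = \<psi> z" by blast
    then have "\<zeta> s = z" using h(3) ck(8) unfolding \<zeta>_def by simp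
    then show "\<zeta> s \<in> C" "g s = \<psi> (\<zeta> s)" "k (\<zeta> s) = snd c (g s)"
      using z ck(8) by simp_all
  qed
  have deriv: "(\<zeta> has_vector_derivative v) (at s within J)" if s: "s \<in> J" for s
  proof -
    have "s \<in> closed_segment 0 t" "g s \<in> fst c"
      using s gJ[OF s] ck(7) by (auto simp: J_def)
    moreover have "\<forall>s\<in>closed_segment 0 t. \<forall>c\<in>A. g s \<in> fst c \<longrightarrow>
        (\<exists>w. ((snd c \<circ> g) has_vector_derivative w) (at s within closed_segment 0 t) \<and>
          \<omega> c (snd c (g s)) * w = v)"
      using g unfolding flow_line_def by simp
    ultimately obtain w where w: "((snd c \<circ> g) has_vector_derivative w) (at s within closed_segment 0 t)"
      "\<omega> c (snd c (g s)) * w = v"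
      using ck(1) by meson
    have "(h has_field_derivative deriv h (k (\<zeta> s))) (at (k (\<zeta> s)))"
      using h(1) open_image gJ(1)[OF s] by (intro holomorphic_derivI) auto
    then have "(h has_field_derivative deriv h (k (\<zeta> s))) (at ((snd c \<circ> g) s) within (snd c \<circ> g) ` J)"
      unfolding gJ(3)[OF s] comp_def by (rule DERIV_subset) simp
    moreover have "((snd c \<circ> g) has_vector_derivative w) (at s within J)"
      using w(1) by (rule has_vector_derivative_within_subset) (auto simp: J_def)
    ultimately have *: "((h \<circ> (snd c \<circ> g)) has_vector_derivative w * deriv h (k (\<zeta> s))) (at s within J)"
      by (rule field_vector_diff_chain_within[rotated])
    have d: "deriv k (\<zeta> s) * deriv h (k (\<zeta> s)) = 1" "\<omega> c (k (\<zeta> s)) * deriv k (\<zeta> s) = 1"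
      using h(2) ck(5) gJ(1)[OF s] by blast+
    \<comment> \<open>Both \<open>deriv h\<close> and the coefficient \<open>\<omega> c\<close> are
      reciprocal to \<open>deriv k\<close>, so they coincide: the flat coordinate \<open>h\<close>
      is a primitive of the form.\<close>
    have "deriv h (k (\<zeta> s)) = (\<omega> c (k (\<zeta> s)) * deriv k (\<zeta> s)) * deriv h (k (\<zeta> s))"
      by (simp only: d(2) mult_1_left)
    then have "deriv h (k (\<zeta> s)) = \<omega> c (k (\<zeta> s))"
      by (simp only: mult.assoc d(1) mult_1_right)
    then have "w * deriv h (k (\<zeta> s)) = v"
      using w(2) gJ(3)[OF s] by (simp add: mult.commute)
    with * show ?thesis by (simp add: \<zeta>_def comp_def)
  qed
  have "((\<lambda>s. \<zeta> s - of_real s * v) has_vector_derivative 0) (at s within J)" if "s \<in> J" for s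
  proof -
    have "((\<lambda>s. of_real s * v) has_vector_derivative v) (at s within J)"
      by (auto intro!: derivative_eq_intros simp: has_vector_derivative_def scaleR_conv_of_real)
    from has_vector_derivative_diff[OF deriv[OF that] this] show ?thesis by simp
  qed
  then obtain e where e: "\<And>s. s \<in> J \<Longrightarrow> \<zeta> s - of_real s * v = e"
    using has_vector_derivative_zero_constant[OF J(1), of "\<lambda>s. \<zeta> s - of_real s * v"] by blast
  have "\<zeta> s0 = z0"
    using inj_onD[OF flat_patch_inj[OF P], of "\<zeta> s0" z0] gJ(1,2)[OF J(2)] s0 by simp
  have aff: "\<zeta> s = z0 + of_real (s - s0) * v" if "s \<in> J" for s
  proof -
    have "\<zeta> s - of_real s * v = z0 - of_real s0 * v"
      using e[OF that] e[OF J(2)] \<open>\<zeta> s0 = z0\<close> by simp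
    then have "\<zeta> s = z0 - of_real s0 * v + of_real s * v" by (simp add: diff_eq_eq)
    then show ?thesis by (simp add: algebra_simps)
  qed
  have "open ((\<lambda>s. z0 + of_real (s - s0) * v) -` C)"
    by (intro continuous_open_vimage C continuous_intros)
  then have "\<forall>\<^sub>F s in nhds s0. s \<in> (\<lambda>s. z0 + of_real (s - s0) * v) -` C"
    using s0(3) by (intro eventually_nhds_in_open) auto
  moreover have "\<forall>\<^sub>F s in nhds s0. s \<in> ball s0 \<delta>"
    using \<delta>(1) by (intro eventually_nhds_in_open) auto
  ultimately show ?thesis
    by eventually_elim (use aff gJ(2) in \<open>auto simp: J_def\<close>)
qed

lemma flow_line_restrict:
  assumes "flow_line A \<omega> v t x g" "s \<in> closed_segment 0 t"
  shows "flow_line A \<omega> v s x g"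
proof -
  have sub: "closed_segment 0 s \<subseteq> closed_segment 0 t"
    using assms(2) by (simp add: subset_closed_segment)
  show ?thesis
    unfolding flow_line_def
  proof (intro conjI ballI impI)
    show "g 0 = x" using assms(1) unfolding flow_line_def by blast
    show "continuous_on (closed_segment 0 s) g"
      using assms(1) sub unfolding flow_line_def by (blast intro: continuous_on_subset)
    fix r assume "r \<in> closed_segment 0 s"
    then have r: "r \<in> closed_segment 0 t" using sub by blast
    then show "g r \<notin> form_zeros A \<omega>" using assms(1) unfolding flow_line_def by blast
    fix c assume "c \<in> A" "g r \<in> fst c"
    then obtain w where w: "((snd c \<circ> g) has_vector_derivative w) (at r within closed_segment 0 t)"
      "\<omega> c (snd c (g r)) * w = v"
      using assms(1) r unfolding flow_line_def by blast
    from has_vector_derivative_within_subset[OF w(1) sub] w(2)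
    show "\<exists>w. ((snd c \<circ> g) has_vector_derivative w) (at r within closed_segment 0 s) \<and>
        \<omega> c (snd c (g r)) * w = v" by blast
  qed
qed

end

section \<open>Forms that vanish on no open set\<close>

locale abelian_form = holomorphic_form +
  assumes not_locally_zero: "\<And>c p. c \<in> A \<Longrightarrow> p \<in> fst c \<Longrightarrow> \<exists>\<^sub>F z in nhds (snd c p). \<omega> c z \<noteq> 0"

lemma (in holomorphic_form) eventually_chart:
  assumes "c \<in> A" "p \<in> fst c" "\<forall>\<^sub>F z in nhds (snd c p). P z"
  shows "\<forall>\<^sub>F q in nhds p. q \<in> fst c \<and> P (snd c q)"
proof -
  obtain S where S: "open S" "snd c p \<in> S" "\<And>z. z \<in> S \<Longrightarrow> P z"
    using assms(3) unfolding eventually_nhds by blast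
  let ?T = "snd c ` fst c \<inter> S"
  have "open (chart_inv c ` ?T)"
    using chart_image_open[OF assms(1)] S(1) by (intro chart_inv_image_open[OF assms(1)]) auto
  moreover have "p \<in> chart_inv c ` ?T"
    using S(2) assms(1,2) by (intro image_eqI[of _ _ "snd c p"]) auto
  moreover have "q \<in> fst c \<and> P (snd c q)" if "q \<in> chart_inv c ` ?T" for q
    using that S(3) assms(1) by auto
  ultimately show ?thesis unfolding eventually_nhds by blast
qed

text \<open>The identity theorem: the interior \<open>Z\<close> of the zero set is also closed,
  since a point outside \<open>Z\<close> has a punctured neighbourhood free of zeros. Connectedness
  then leaves \<open>Z\<close> empty.\<close>

lemma (in holomorphic_form) abelian_form_of_connected:
  assumes "connected (UNIV :: 'a set)" "form_zeros A \<omega> \<noteq> UNIV"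
  shows "abelian_form A \<omega>"
proof unfold_locales
  define Z where "Z = {p. \<forall>\<^sub>F q in nhds p. q \<in> form_zeros A \<omega>}"
  have Z_chart: "p \<in> Z" if "c \<in> A" "p \<in> fst c" "\<forall>\<^sub>F z in nhds (snd c p). \<omega> c z = 0" for c p
    using eventually_chart[OF that] form_zeros_chart[OF that(1)]
    unfolding Z_def by (auto elim: eventually_mono)
  have "open Z"
    unfolding open_subopen[of Z]
  proof
    fix p assume "p \<in> Z"
    then obtain S where "open S" "p \<in> S" "S \<subseteq> form_zeros A \<omega>"
      unfolding Z_def eventually_nhds by blast
    then show "\<exists>T. open T \<and> p \<in> T \<and> T \<subseteq> Z"
      unfolding Z_def eventually_nhds by (intro exI[of _ S]) auto
  qed
  moreover have "open (- Z)"
    unfolding open_subopen[of "- Z"]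
  proof
    fix p assume p: "p \<in> - Z"
    obtain c where c: "c \<in> A" "p \<in> fst c" by (rule chart_covers)
    obtain r where r: "r > 0" "ball (snd c p) r \<subseteq> snd c ` fst c"
      using chart_image_open[OF c(1)] c(2) openE by (metis imageI)
    have "\<not> (\<forall>\<^sub>F z in nhds (snd c p). \<omega> c z = 0)"
      using Z_chart c p by blast
    moreover have "\<forall>\<^sub>F z in nhds (snd c p). z \<in> ball (snd c p) r"
      using r(1) by (intro eventually_nhds_in_open) auto
    ultimately obtain b where b: "b \<in> ball (snd c p) r" "\<omega> c b \<noteq> 0"
      by (metis (mono_tags, lifting) eventually_mono)
    have "\<forall>\<^sub>F w in at (snd c p). \<omega> c w \<noteq> 0 \<and> w \<in> ball (snd c p) r"
      using holomorphic_on_subset[OF coefficient_holomorphic[OF c(1)] r(2)] r(1) b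
      by (intro non_zero_neighbour_alt) auto
    then have "\<forall>\<^sub>F w in nhds (snd c p). w \<noteq> snd c p \<longrightarrow> \<omega> c w \<noteq> 0"
      unfolding eventually_at_filter by (auto elim: eventually_mono)
    from eventually_chart[OF c this] obtain T where T: "open T" "p \<in> T"
      "\<And>q. q \<in> T \<Longrightarrow> q \<in> fst c \<and> (snd c q \<noteq> snd c p \<longrightarrow> \<omega> c (snd c q) \<noteq> 0)"
      unfolding eventually_nhds by blast
    have "T \<subseteq> - Z"
    proof
      fix q assume "q \<in> T"
      show "q \<in> - Z"
      proof (cases "q = p")
        case False
        then have "snd c q \<noteq> snd c p"
          using chart_inv(1)[OF c(1)] c(2) T(3)[OF \<open>q \<in> T\<close>] by metis
        then have "q \<notin> form_zeros A \<omega>"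
          using T(3)[OF \<open>q \<in> T\<close>] form_zeros_chart[OF c(1)] by blast
        then show ?thesis unfolding Z_def using eventually_nhds_x_imp_x by blast
      qed (use p in simp)
    qed
    with T(1,2) show "\<exists>T. open T \<and> p \<in> T \<and> T \<subseteq> - Z" by blast
  qed
  ultimately have "Z = {} \<or> - Z = {}"
    using connectedD[OF assms(1), of Z "- Z"] by auto
  moreover have "Z \<noteq> UNIV"
    using assms(2) eventually_nhds_x_imp_x unfolding Z_def by blast
  ultimately have "Z = {}" by auto
  then show "\<exists>\<^sub>F z in nhds (snd c p). \<omega> c z \<noteq> 0" if "c \<in> A" "p \<in> fst c" for c p
    using Z_chart[OF that] unfolding frequently_def by auto
qed

context abelian_form
begin

lemma local_normal_form:
  obtains c n \<rho> \<kappa> where "c \<in> A" "p \<in> fst c" "0 < n" "0 < \<rho>" "\<kappa> holomorphic_on ball 0 \<rho>"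
    "inj_on \<kappa> (ball 0 \<rho>)" "\<kappa> ` ball 0 \<rho> \<subseteq> snd c ` fst c" "\<kappa> 0 = snd c p"
    "\<And>w. w \<in> ball 0 \<rho> \<Longrightarrow> \<omega> c (\<kappa> w) * deriv \<kappa> w = of_nat n * w ^ (n - 1)"
proof -
  obtain c where c: "c \<in> A" "p \<in> fst c" by (rule chart_covers)
  then have "snd c p \<in> snd c ` fst c" by blast
  from holomorphic_form_normal_form[OF coefficient_holomorphic[OF c(1)] chart_image_open[OF c(1)] this
      not_locally_zero[OF c]] that[OF c]
  show thesis by metis
qed

text \<open>The normal form must have \<open>n = 1\<close>: at \<open>w = 0\<close> its left side is
  a product of two nonzero factors, while \<open>0 ^ (n - 1)\<close> vanishes for larger
  \<open>n\<close>. Then the form is \<open>dw\<close> in this coordinate.\<close>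

lemma regular_patch:
  assumes "p \<notin> form_zeros A \<omega>"
  obtains \<rho> \<psi> where "\<rho> > 0" "flat_patch (ball 0 \<rho>) \<psi>" "\<psi> 0 = p"
proof -
  obtain c n \<rho> \<kappa> where *: "c \<in> A" "p \<in> fst c" "0 < n" "0 < \<rho>" "\<kappa> holomorphic_on ball 0 \<rho>"
    "inj_on \<kappa> (ball 0 \<rho>)" "\<kappa> ` ball 0 \<rho> \<subseteq> snd c ` fst c" "\<kappa> 0 = snd c p"
    "\<And>w. w \<in> ball 0 \<rho> \<Longrightarrow> \<omega> c (\<kappa> w) * deriv \<kappa> w = of_nat n * w ^ (n - 1)"
    using local_normal_form[of p] by metis
  have "\<omega> c (\<kappa> 0) \<noteq> 0"
    using assms form_zeros_chart[OF *(1,2)] *(8) by simp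
  moreover have "deriv \<kappa> 0 \<noteq> 0"
    using holomorphic_injective_imp_regular[OF *(5) open_ball *(6)] *(4) by simp
  ultimately have "of_nat n * (0::complex) ^ (n - 1) \<noteq> 0"
    using *(9)[of 0] *(4) by (metis centre_in_ball mult_eq_0_iff)
  then have "n = 1" using *(3) by (cases "n - 1") auto
  then have "\<omega> c (\<kappa> w) * deriv \<kappa> w = 1" if "w \<in> ball 0 \<rho>" for w
    using *(9)[OF that] by simp
  then have "flat_patch (ball 0 \<rho>) (chart_inv c \<circ> \<kappa>)"
    unfolding flat_patch_def using *(1,5,6,7) by (auto intro!: bexI[of _ c] exI[of _ \<kappa>])
  moreover have "(chart_inv c \<circ> \<kappa>) 0 = p" using *(1,2,8) by simp
  ultimately show thesis using that *(4) by blast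
qed

section \<open>Uniqueness of flow lines\<close>

lemma eventually_flow_line_eq:
  assumes "flow_line A \<omega> v t x g1" "flow_line A \<omega> v t x g2" "s \<in> closed_segment 0 t" "g1 s = g2 s"
  shows "\<forall>\<^sub>F r in nhds s. r \<in> closed_segment 0 t \<longrightarrow> g1 r = g2 r"
proof -
  have "g1 s \<notin> form_zeros A \<omega>"
    using assms(1,3) unfolding flow_line_def by blast
  then obtain \<rho> \<psi> where \<psi>: "\<rho> > 0" "flat_patch (ball 0 \<rho>) \<psi>" "\<psi> 0 = g1 s"
    by (rule regular_patch)
  have "g1 s = \<psi> 0" "g2 s = \<psi> 0" "0 \<in> ball 0 \<rho>" using \<psi>(1,3) assms(4) by auto
  from flow_line_flat_patch[OF \<psi>(2) assms(1) assms(3) this(1,3)]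
    flow_line_flat_patch[OF \<psi>(2) assms(2) assms(3) this(2,3)]
  show ?thesis by eventually_elim auto
qed

lemma eventually_flow_line_neq:
  assumes "flow_line A \<omega> v t x g1" "flow_line A \<omega> v t x g2" "s \<in> closed_segment 0 t" "g1 s \<noteq> g2 s"
  shows "\<forall>\<^sub>F r in nhds s. r \<in> closed_segment 0 t \<longrightarrow> g1 r \<noteq> g2 r"
proof -
  obtain U V where UV: "open U" "open V" "g1 s \<in> U" "g2 s \<in> V" "U \<inter> V = {}"
    using assms(4) by (rule hausdorff[THEN exE]) blast
  have "continuous_on (closed_segment 0 t) g1" "continuous_on (closed_segment 0 t) g2"
    using assms(1,2) unfolding flow_line_def by auto
  then obtain S T where "open S" "s \<in> S" "\<And>r. r \<in> closed_segment 0 t \<Longrightarrow> r \<in> S \<Longrightarrow> g1 r \<in> U"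
    and "open T" "s \<in> T" "\<And>r. r \<in> closed_segment 0 t \<Longrightarrow> r \<in> T \<Longrightarrow> g2 r \<in> V"
    using UV(1-4) assms(3) unfolding continuous_on_topological by metis
  then have "open (S \<inter> T)" "s \<in> S \<inter> T"
    "\<And>r. r \<in> closed_segment 0 t \<Longrightarrow> r \<in> S \<inter> T \<Longrightarrow> g1 r \<in> U \<and> g2 r \<in> V"
    by auto
  then have "\<forall>\<^sub>F r in nhds s. r \<in> S \<inter> T" by (intro eventually_nhds_in_open)
  then show ?thesis
  proof eventually_elim
    case (elim r)
    show ?case
    proof
      assume "r \<in> closed_segment 0 t"
      then have "g1 r \<in> U" "g2 r \<in> V"
        using elim \<open>\<And>r. r \<in> closed_segment 0 t \<Longrightarrow> r \<in> S \<inter> T \<Longrightarrow> g1 r \<in> U \<and> g2 r \<in> V\<close> by auto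
      then show "g1 r \<noteq> g2 r" using UV(5) by auto
    qed
  qed
qed

text \<open>Whether the two lines agree is locally constant in time: agreement spreads because both
  are the same straight segment in a flat patch, disagreement because the surface is
  Hausdorff.\<close>

lemma flow_line_unique:
  assumes "flow_line A \<omega> v t x g1" "flow_line A \<omega> v t x g2" "s \<in> closed_segment 0 t"
  shows "g1 s = g2 s"
proof -
  have "(g1 0 = g2 0) = (g1 s = g2 s)"
  proof (rule connected_local_const[of "closed_segment 0 t" 0 s "\<lambda>s. g1 s = g2 s"])
    show "\<forall>r\<in>closed_segment 0 t. \<forall>\<^sub>F b in at r within closed_segment 0 t. (g1 r = g2 r) = (g1 b = g2 b)"
    proof
      fix r assume r: "r \<in> closed_segment 0 t"
      show "\<forall>\<^sub>F b in at r within closed_segment 0 t. (g1 r = g2 r) = (g1 b = g2 b)"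
        using eventually_flow_line_eq[OF assms(1,2) r] eventually_flow_line_neq[OF assms(1,2) r]
        unfolding eventually_at_filter by (cases "g1 r = g2 r") (auto elim: eventually_mono)
    qed
  qed (use assms(3) in auto)
  then show ?thesis using assms(1,2) unfolding flow_line_def by simp
qed

lemma flow_eq:
  assumes "flow_line A \<omega> v t x g"
  shows "flow_defined A \<omega> v t x" "flow A \<omega> v t x = g t"
proof -
  show "flow_defined A \<omega> v t x" using assms unfolding flow_defined_def by blast
  show "flow A \<omega> v t x = g t"
    unfolding flow_def
  proof (rule the_equality)
    fix y assume "\<exists>h. flow_line A \<omega> v t x h \<and> h t = y"
    then obtain h where "flow_line A \<omega> v t x h" "h t = y" by blast
    then show "y = g t" using flow_line_unique[OF _ assms ends_in_segment(2), of h] by simp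
  qed (rule exI[of _ g], simp add: assms)
qed

section \<open>Flows and displacements in flat coordinates\<close>

lemma flat_patch_flow:
  assumes "flat_patch C \<psi>" "z \<in> C" "z + of_real t * v \<in> C"
  shows "flow_defined A \<omega> v t (\<psi> z)" "flow A \<omega> v t (\<psi> z) = \<psi> (z + of_real t * v)"
  using flow_eq[OF flat_patch_flow_line[OF assms]] by auto

text \<open>Translation by \<open>z\<close> in flat coordinates, with the horizontal step first as
  in \<open>rectangle_map\<close>. Being expressed by the flows, it refers to no particular
  patch.\<close>

definition displacement :: "'a \<Rightarrow> complex \<Rightarrow> 'a" where
  "displacement q z = vflow A \<omega> (Im z) (hflow A \<omega> (Re z) q)"

lemma displacement_flat_patch:
  assumes "flat_patch C \<psi>" "z0 \<in> C"
  shows "\<forall>\<^sub>F z in nhds 0. z0 + z \<in> C \<and> z0 + of_real (Re z) \<in> C \<and> displacement (\<psi> z0) z = \<psi> (z0 + z)"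
proof -
  have "open ((\<lambda>z. z0 + z) -` C)" "open ((\<lambda>z. z0 + of_real (Re z)) -` C)"
    by (intro open_vimage[OF flat_patch_open[OF assms(1)]] continuous_intros)+
  then have "\<forall>\<^sub>F z in nhds 0. z \<in> (\<lambda>z. z0 + z) -` C" "\<forall>\<^sub>F z in nhds 0. z \<in> (\<lambda>z. z0 + of_real (Re z)) -` C"
    using assms(2) by (intro eventually_nhds_in_open; simp)+
  then show ?thesis
  proof eventually_elim
    case (elim z)
    have eq: "z0 + of_real (Re z) + of_real (Im z) * \<i> = z0 + z"
      by (simp add: complex_eq_iff)
    have h: "hflow A \<omega> (Re z) (\<psi> z0) = \<psi> (z0 + of_real (Re z))"
      using flat_patch_flow(2)[OF assms, of "Re z" 1] elim by simp
    have "z0 + of_real (Re z) + of_real (Im z) * \<i> \<in> C"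
      unfolding eq using elim by simp
    from flat_patch_flow(2)[OF assms(1) _ this] elim have
      "vflow A \<omega> (Im z) (\<psi> (z0 + of_real (Re z))) = \<psi> (z0 + z)"
      unfolding eq by simp
    with h elim show ?case
      by (simp add: displacement_def)
  qed
qed

text \<open>Small displacements sweep out a neighbourhood of a regular point, since they are
  translations in a flat coordinate and \<open>\<psi>\<close> is an open map.\<close>

lemma eventually_displacement:
  assumes "q \<notin> form_zeros A \<omega>" "\<forall>\<^sub>F z in nhds 0. P (displacement q z)"
  shows "\<forall>\<^sub>F y in nhds q. P y"
proof -
  obtain \<rho> \<psi> where \<psi>: "\<rho> > 0" "flat_patch (ball 0 \<rho>) \<psi>" "\<psi> 0 = q"
    using assms(1) by (rule regular_patch)
  have "\<forall>\<^sub>F z in nhds 0. z \<in> ball 0 \<rho> \<and> P (\<psi> z)"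
    using displacement_flat_patch[OF \<psi>(2), of 0] \<psi>(1) assms(2) unfolding \<psi>(3)
    by (auto elim: eventually_elim2)
  then obtain S where S: "open S" "0 \<in> S" "S \<subseteq> ball 0 \<rho>" "\<And>z. z \<in> S \<Longrightarrow> P (\<psi> z)"
    unfolding eventually_nhds by blast
  then show ?thesis
    unfolding eventually_nhds using flat_patch_image_open[OF \<psi>(2) S(1,3)] \<psi>(3)
    by (intro exI[of _ "\<psi> ` S"]) auto
qed

end

section \<open>Admissible rectangles in flat patches\<close>

lemma embedding_map_of_compact:
  fixes f :: "'b::topological_space \<Rightarrow> 'c::t2_space"
  assumes "compact K" "continuous_on K f" "inj_on f K" "S \<subseteq> K"
  shows "embedding_map (top_of_set S) euclidean f"
proof -
  obtain h where "homeomorphism K (f ` K) f h"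
    using homeomorphism_compact[OF assms(1,2) refl assms(3)] by blast
  then have "homeomorphism S (f ` S) f h"
    by (rule homeomorphism_of_subsets) (use assms(4) in auto)
  then show ?thesis
    unfolding embedding_map_def homeomorphic_map_maps homeomorphic_maps_def homeomorphism_def
    by (intro exI[of _ h]) auto
qed

context abelian_form
begin

text \<open>By convexity the whole closed rectangle lies in \<open>C\<close> once its corners do.
  Its compactness gives the embedding, and also makes its image closed, so the closure of the
  half-open rectangle stays in the zero-free patch.\<close>

lemma flat_patch_admissible:
  assumes P: "flat_patch C \<psi>" and ab: "0 < a" "0 < b"
    and C: "z \<in> C" "z + of_real a \<in> C" "z + of_real b * \<i> \<in> C" "z + of_real a + of_real b * \<i> \<in> C"
  shows "admissible A \<omega> (\<psi> z) b a"
proof -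
  let ?K = "{0..b} \<times> {0..a}" and ?S = "{0..<b} \<times> {0..<a}"
  define m where "m = (\<lambda>(r1::real, r2::real). z + of_real r2 + of_real r1 * \<i>)"
  have seg: "closed_segment 0 t = {0..t}" if "0 < t" for t :: real
    using that by (simp add: closed_segment_eq_real_ivl)
  have inC1: "z + of_real r2 \<in> C" "z + of_real r2 + of_real b * \<i> \<in> C" if "r2 \<in> {0..a}" for r2
    using flat_patch_segment[OF P C(1), of a 1 r2] flat_patch_segment[OF P C(3), of a 1 r2] C that seg[OF ab(1)]
    by (auto simp: algebra_simps)
  have inC: "z + of_real r2 + of_real r1 * \<i> \<in> C" if "r1 \<in> {0..b}" "r2 \<in> {0..a}" for r1 r2
    using flat_patch_segment[OF P inC1(1)[OF that(2)], of b \<i> r1] inC1(2)[OF that(2)] that seg[OF ab(2)]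
    by auto
  have hf: "hflow_defined A \<omega> r2 (\<psi> z)" "hflow A \<omega> r2 (\<psi> z) = \<psi> (z + of_real r2)" if "r2 \<in> {0..a}" for r2
    using flat_patch_flow[OF P C(1), of r2 1] inC1(1)[OF that] by simp_all
  have vf: "vflow_defined A \<omega> r1 (\<psi> (z + of_real r2))"
    "vflow A \<omega> r1 (\<psi> (z + of_real r2)) = \<psi> (z + of_real r2 + of_real r1 * \<i>)"
    if "r1 \<in> {0..b}" "r2 \<in> {0..a}" for r1 r2
    using flat_patch_flow[OF P inC1(1)[OF that(2)], of r1 \<i>] inC[OF that] by simp_all
  have mC: "m ` ?K \<subseteq> C" using inC by (auto simp: m_def)
  have rm: "rectangle_map A \<omega> (\<psi> z) r = (\<psi> \<circ> m) r" if "r \<in> ?K" for r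
  proof -
    obtain r1 r2 where "r = (r1, r2)" "r1 \<in> {0..b}" "r2 \<in> {0..a}" using \<open>r \<in> ?K\<close> by blast
    then show ?thesis by (simp add: rectangle_map_def m_def hf(2) vf(2) del: atLeastAtMost_iff)
  qed
  have cont: "continuous_on ?K (\<psi> \<circ> m)"
    by (intro continuous_on_compose continuous_on_subset[OF flat_patch_continuous[OF P] mC])
      (auto simp: m_def case_prod_beta intro!: continuous_intros)
  have "inj m"
    by (auto simp: inj_on_def m_def complex_eq_iff)
  then have inj: "inj_on (\<psi> \<circ> m) ?K"
    using flat_patch_inj[OF P] mC by (intro comp_inj_on) (auto elim: inj_on_subset)
  have K: "compact ?K" by (intro compact_Times compact_Icc)
  have "embedding_map (top_of_set ?S) euclidean (\<psi> \<circ> m)"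
    using K cont inj by (rule embedding_map_of_compact) auto
  then have emb: "embedding_map (top_of_set ?S) euclidean (rectangle_map A \<omega> (\<psi> z))"
    by (rule embedding_map_eq) (use rm in auto)
  have "rectangle A \<omega> (\<psi> z) b a \<subseteq> (\<psi> \<circ> m) ` ?K"
    using rm by (force simp: rectangle_def)
  moreover have "closed ((\<psi> \<circ> m) ` ?K)"
    using compact_continuous_image[OF cont K] by (rule compact_imp_closed)
  ultimately have "closure (rectangle A \<omega> (\<psi> z) b a) \<subseteq> (\<psi> \<circ> m) ` ?K"
    by (rule closure_minimal)
  then have "closure (rectangle A \<omega> (\<psi> z) b a) \<inter> form_zeros A \<omega> = {}"
    using flat_patch_regular[OF P] mC by (auto simp: image_subset_iff)
  moreover have "hflow_defined A \<omega> r2 (\<psi> z) \<and> vflow_defined A \<omega> r1 (hflow A \<omega> r2 (\<psi> z))"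
    if "r1 \<in> {0..<b}" "r2 \<in> {0..<a}" for r1 r2
    using hf[of r2] vf(1)[of r1 r2] that by simp
  ultimately show ?thesis
    unfolding admissible_def using ab emb by simp
qed

end

section \<open>Cocycles on a flat patch\<close>

locale vertical_cocycle = abelian_form +
  fixes \<Phi> :: "'a \<Rightarrow> real \<Rightarrow> real"
  assumes Bc: "\<Phi> \<in> Bc_plus A \<omega>"
begin

lemma cocycle:
  "vflow_defined A \<omega> t x \<Longrightarrow> vflow_defined A \<omega> s (vflow A \<omega> t x) \<Longrightarrow>
   \<Phi> x (t + s) = \<Phi> x t + \<Phi> (vflow A \<omega> t x) s"
  using Bc unfolding Bc_plus_def by blast

lemma small:
  assumes "\<epsilon> > 0"
  obtains \<delta> where "\<delta> > 0" "\<And>x t. \<bar>t\<bar> < \<delta> \<Longrightarrow> vflow_defined A \<omega> t x \<Longrightarrow> \<bar>\<Phi> x t\<bar> \<le> \<epsilon>"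
  using Bc assms unfolding Bc_plus_def by blast

lemma holonomy:
  "admissible A \<omega> x t1 t2 \<Longrightarrow> vflow_defined A \<omega> t1 x \<Longrightarrow> hflow_defined A \<omega> t2 x \<Longrightarrow>
   vflow_defined A \<omega> t1 (hflow A \<omega> t2 x) \<Longrightarrow> \<Phi> (hflow A \<omega> t2 x) t1 = \<Phi> x t1"
  using Bc unfolding Bc_plus_def by force

lemma patch_cocycle:
  assumes "flat_patch C \<psi>" "z \<in> C" "z + of_real t * \<i> \<in> C" "z + of_real (t + s) * \<i> \<in> C"
  shows "\<Phi> (\<psi> z) (t + s) = \<Phi> (\<psi> z) t + \<Phi> (\<psi> (z + of_real t * \<i>)) s"
proof -
  have "z + of_real t * \<i> + of_real s * \<i> \<in> C" using assms(4) by (simp add: algebra_simps)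
  then show ?thesis
    using flat_patch_flow[OF assms(1-3)] flat_patch_flow(1)[OF assms(1,3)] cocycle by metis
qed

lemma patch_zero:
  assumes "flat_patch C \<psi>" "z \<in> C"
  shows "\<Phi> (\<psi> z) 0 = 0"
  using patch_cocycle[OF assms, of 0 0] assms(2) by simp

lemma patch_minus:
  assumes "flat_patch C \<psi>" "z \<in> C" "z + of_real t * \<i> \<in> C"
  shows "\<Phi> (\<psi> (z + of_real t * \<i>)) (- t) = - \<Phi> (\<psi> z) t"
  using patch_cocycle[OF assms, of "- t"] patch_zero[OF assms(1,2)] assms(2) by simp

text \<open>\<open>admissible\<close> covers only positive sides. For \<open>a < 0\<close> the two
  vertical sides exchange roles; for \<open>b < 0\<close> both arcs are reversed by
  \<open>patch_minus\<close> and start from their other ends.\<close>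

lemma patch_holonomy:
  assumes P: "flat_patch C \<psi>"
    and C: "z \<in> C" "z + of_real a \<in> C" "z + of_real b * \<i> \<in> C" "z + of_real a + of_real b * \<i> \<in> C"
  shows "\<Phi> (\<psi> (z + of_real a)) b = \<Phi> (\<psi> z) b"
proof -
  have pos: "\<Phi> (\<psi> (z + of_real a)) b = \<Phi> (\<psi> z) b"
    if "z \<in> C" "z + of_real a \<in> C" "z + of_real b * \<i> \<in> C" "z + of_real a + of_real b * \<i> \<in> C"
      "0 < a" "0 < b" for z a b
    using holonomy[OF flat_patch_admissible[OF P that(5,6,1-4)]] flat_patch_flow(1)[OF P that(1,3)]
      flat_patch_flow[OF P that(1), of a 1] flat_patch_flow(1)[OF P that(2,4)] that(2) by simp
  have up: "\<Phi> (\<psi> (z + of_real a)) b = \<Phi> (\<psi> z) b"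
    if "z \<in> C" "z + of_real a \<in> C" "z + of_real b * \<i> \<in> C" "z + of_real a + of_real b * \<i> \<in> C"
      "0 < b" for z a b
  proof (cases a "0::real" rule: linorder_cases)
    case less
    then show ?thesis using pos[of "z + of_real a" "- a" b] that by (simp add: algebra_simps)
  qed (use pos[OF that(1-4) _ that(5)] in auto)
  show ?thesis
  proof (cases b "0::real" rule: linorder_cases)
    case less
    let ?z = "z + of_real b * \<i>"
    have "\<Phi> (\<psi> (?z + of_real a)) (- b) = \<Phi> (\<psi> ?z) (- b)"
      using less C by (intro up) (auto simp: algebra_simps)
    then show ?thesis
      using patch_minus[OF P C(1,3)] patch_minus[OF P C(2,4)] by (simp add: algebra_simps)
  next
    case equal
    then show ?thesis using patch_zero[OF P] C by simp
  next
    case greater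
    then show ?thesis using up[OF C] by blast
  qed
qed

end

section \<open>Local primitives of a cocycle\<close>

context abelian_form
begin

text \<open>Near an arbitrary point \<open>p\<close> there is a primitive \<open>\<zeta>\<close> of the form which is the \<open>n\<close>-th power of
  a local coordinate; on each half disc, \<open>\<zeta>\<close> is inverted by a branch of the \<open>n\<close>-th root.\<close>

lemma half_disc_patches:
  obtains N \<zeta> R where "open N" "p \<in> N" "\<zeta> p = 0"
    "\<And>q. q \<in> N - {p} \<Longrightarrow> \<zeta> q \<noteq> 0 \<and> cmod (\<zeta> q) < R"
    "\<And>q e. q \<in> N - {p} \<Longrightarrow> cmod e = 1 \<Longrightarrow> 0 < Re (\<zeta> q / e) \<Longrightarrow>
       \<exists>\<psi>. flat_patch {z. cmod z < R \<and> 0 < Re (z / e)} \<psi> \<and> \<psi> (\<zeta> q) = q \<and>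
         (\<forall>z. cmod z < R \<and> 0 < Re (z / e) \<longrightarrow> \<psi> z \<in> N - {p} \<and> \<zeta> (\<psi> z) = z)"
proof -
  obtain c n \<rho> \<kappa> where c: "c \<in> A" "p \<in> fst c" and n: "0 < n" and \<rho>: "0 < \<rho>"
    and \<kappa>: "\<kappa> holomorphic_on ball 0 \<rho>" "inj_on \<kappa> (ball 0 \<rho>)" "\<kappa> ` ball 0 \<rho> \<subseteq> snd c ` fst c" "\<kappa> 0 = snd c p"
    "\<And>w. w \<in> ball 0 \<rho> \<Longrightarrow> \<omega> c (\<kappa> w) * deriv \<kappa> w = of_nat n * w ^ (n - 1)"
    using local_normal_form[of p] by metis
  define \<eta> where "\<eta> = chart_inv c \<circ> \<kappa>"
  define N where "N = \<eta> ` ball 0 \<rho>"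
  have \<eta>_inj: "inj_on \<eta> (ball 0 \<rho>)"
    unfolding \<eta>_def using \<kappa>(2) inj_on_inv_into[OF \<kappa>(3)] by (rule comp_inj_on)
  define \<zeta> where "\<zeta> = (\<lambda>q. inv_into (ball 0 \<rho>) \<eta> q ^ n)"
  have \<zeta>_\<eta>: "\<zeta> (\<eta> w) = w ^ n" if "w \<in> ball 0 \<rho>" for w
    using inv_into_f_f[OF \<eta>_inj that] by (simp add: \<zeta>_def)
  have \<eta>0: "\<eta> 0 = p" using c \<kappa>(4) by (simp add: \<eta>_def)
  have N_p: "\<exists>w. w \<in> ball 0 \<rho> \<and> w \<noteq> 0 \<and> q = \<eta> w" if "q \<in> N - {p}" for q
    using that \<eta>0 by (auto simp: N_def)
  show thesis
  proof (rule that[of N \<zeta> "\<rho> ^ n"])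
    have "open (\<kappa> ` ball 0 \<rho>)" using open_mapping_thm3[OF \<kappa>(1) open_ball \<kappa>(2)] .
    then have "open (chart_inv c ` \<kappa> ` ball 0 \<rho>)" by (rule chart_inv_image_open[OF c(1) _ \<kappa>(3)])
    then show "open N" by (simp add: N_def \<eta>_def image_comp)
    show "p \<in> N" using \<eta>0 \<rho> unfolding N_def by (intro image_eqI[of _ _ 0]) auto
    show "\<zeta> p = 0" using \<zeta>_\<eta>[of 0] \<eta>0 \<rho> n by simp
  next
    fix q assume "q \<in> N - {p}"
    then obtain w where "w \<in> ball 0 \<rho>" "w \<noteq> 0" "q = \<eta> w" using N_p by blast
    then show "\<zeta> q \<noteq> 0 \<and> cmod (\<zeta> q) < \<rho> ^ n"
      using n by (simp add: \<zeta>_\<eta> norm_power power_strict_mono)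
  next
    fix q e assume q: "q \<in> N - {p}" and e: "cmod e = 1" "0 < Re (\<zeta> q / e)"
    define C where "C = {z. cmod z < \<rho> ^ n \<and> 0 < Re (z / e)}"
    obtain w where w: "w \<in> ball 0 \<rho>" "w \<noteq> 0" "q = \<eta> w" using N_p[OF q] by blast
    have "e \<noteq> 0" using e(1) by auto
    have C_nz: "z \<noteq> 0" "z / e \<notin> \<real>\<^sub>\<le>\<^sub>0" if "z \<in> C" for z
      using that by (auto simp: C_def complex_nonpos_Reals_iff)
    have "\<zeta> q \<in> C"
      using w n e(2) unfolding C_def by (simp add: \<zeta>_\<eta> norm_power power_strict_mono)
    \<comment> \<open>The factor \<open>a\<close> is an \<open>n\<close>-th root of \<open>e\<close>
      and selects the branch \<open>r\<close> of the root with \<open>r (\<zeta> q) = w\<close>, so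
      that the patch passes through \<open>q\<close> and not through another preimage of
      \<open>\<zeta> q\<close>. On \<open>C\<close> the quotient \<open>z / e\<close> stays in the
      right half-plane, where \<open>Ln\<close> is holomorphic.\<close>
    define a where "a = w / exp (Ln (\<zeta> q / e) / of_nat n)"
    define r where "r = (\<lambda>z. a * exp (Ln (z / e) / of_nat n))"
    have exp_pow: "exp (Ln (z / e) / of_nat n) ^ n = z / e" if "z \<in> C" for z
      using n C_nz(1)[OF that] \<open>e \<noteq> 0\<close> by (simp flip: exp_of_nat_mult)
    have "a ^ n = e"
      using exp_pow[OF \<open>\<zeta> q \<in> C\<close>] \<zeta>_\<eta>[OF w(1)] w C_nz(1)[OF \<open>\<zeta> q \<in> C\<close>] by (simp add: a_def power_divide)
    then have r_pow: "r z ^ n = z" if "z \<in> C" for z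
      using exp_pow[OF that] \<open>e \<noteq> 0\<close> by (simp add: r_def power_mult_distrib)
    have r_ball: "r z \<in> ball 0 \<rho>" if "z \<in> C" for z
    proof -
      have "cmod (r z) ^ n < \<rho> ^ n"
        using that r_pow[OF that] by (simp add: C_def flip: norm_power)
      then show ?thesis using \<rho> by (simp add: power_less_imp_less_base)
    qed
    have r_nz: "r z \<noteq> 0" if "z \<in> C" for z
      using r_pow[OF that] C_nz(1)[OF that] n by auto
    have r_deriv: "(r has_field_derivative r z / (of_nat n * z)) (at z)" if "z \<in> C" for z
      unfolding r_def using C_nz[OF that] \<open>e \<noteq> 0\<close> n
      by (auto intro!: derivative_eq_intros simp: field_simps)
    have r_inj: "inj_on r C" using r_pow by (metis inj_onI)
    have \<eta>r: "\<eta> (r z) \<in> N - {p}" "\<zeta> (\<eta> (r z)) = z" if "z \<in> C" for z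
    proof -
      show "\<zeta> (\<eta> (r z)) = z" using \<zeta>_\<eta>[OF r_ball[OF that]] r_pow[OF that] by simp
      then have "\<eta> (r z) \<noteq> p"
        using C_nz(1)[OF that] \<zeta>_\<eta>[of 0] \<eta>0 \<rho> n by auto
      then show "\<eta> (r z) \<in> N - {p}" using r_ball[OF that] by (simp add: N_def)
    qed
    have "open C"
    proof -
      have "C = ball 0 (\<rho> ^ n) \<inter> (\<lambda>z. Re (z / e)) -` {0<..}" by (auto simp: C_def)
      moreover have "open ((\<lambda>z. Re (z / e)) -` {0<..})"
        using \<open>e \<noteq> 0\<close> by (intro open_vimage continuous_intros) auto
      ultimately show ?thesis by auto
    qed
    moreover have "convex C"
    proof -
      have "C = ball 0 (\<rho> ^ n) \<inter> (\<lambda>z. Re (z / e)) -` {0<..}" by (auto simp: C_def)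
      moreover have "linear (\<lambda>z. Re (z / e))"
        by (intro linearI) (simp_all add: divide_inverse distrib_right)
      then have "convex ((\<lambda>z. Re (z / e)) -` {0<..})"
        by (rule convex_linear_vimage) simp
      ultimately show ?thesis by (auto intro: convex_Int)
    qed
    moreover have "(\<kappa> \<circ> r) holomorphic_on C"
    proof (rule holomorphic_on_compose_gen[OF _ \<kappa>(1)])
      show "r holomorphic_on C"
        using r_deriv by (meson field_differentiable_at_within field_differentiable_def holomorphic_onI)
    qed (use r_ball in auto)
    moreover have "inj_on (\<kappa> \<circ> r) C"
      using r_inj \<kappa>(2) r_ball by (intro comp_inj_on) (auto elim!: inj_on_subset)
    moreover have "(\<kappa> \<circ> r) ` C \<subseteq> snd c ` fst c"
      using r_ball \<kappa>(3) by auto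
    \<comment> \<open>The pulled-back coefficient is \<open>n * r ^ (n - 1)\<close> times the
      derivative \<open>r / (n * z)\<close> of the root, that is
      \<open>r ^ n / z = 1\<close>.\<close>
    moreover have "\<omega> c ((\<kappa> \<circ> r) z) * deriv (\<kappa> \<circ> r) z = 1" if "z \<in> C" for z
    proof -
      have "(\<kappa> has_field_derivative deriv \<kappa> (r z)) (at (r z))"
        using \<kappa>(1) r_ball[OF that] by (intro holomorphic_derivI) auto
      then have "((\<kappa> \<circ> r) has_field_derivative deriv \<kappa> (r z) * (r z / (of_nat n * z))) (at z)"
        unfolding comp_def using r_deriv[OF that] by (rule DERIV_chain2)
      then have "\<omega> c ((\<kappa> \<circ> r) z) * deriv (\<kappa> \<circ> r) z =
          (\<omega> c (\<kappa> (r z)) * deriv \<kappa> (r z)) * (r z / (of_nat n * z))"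
        by (simp add: DERIV_imp_deriv)
      also have "\<dots> = (r z ^ (n - 1) * r z) / z"
        using n \<kappa>(5)[OF r_ball[OF that]] by simp
      also have "r z ^ (n - 1) * r z = z"
        using r_pow[OF that] power_minus_mult[OF n, of "r z"] by simp
      finally show ?thesis using C_nz(1)[OF that] by (simp add: comp_def)
    qed
    ultimately have "flat_patch C (\<eta> \<circ> r)"
      unfolding flat_patch_def \<eta>_def using c(1) by (intro conjI bexI[of _ c] exI[of _ "\<kappa> \<circ> r"]) auto
    moreover have "r (\<zeta> q) = w" by (simp add: r_def a_def)
    ultimately show "\<exists>\<psi>. flat_patch {z. cmod z < \<rho> ^ n \<and> 0 < Re (z / e)} \<psi> \<and> \<psi> (\<zeta> q) = q \<and>
         (\<forall>z. cmod z < \<rho> ^ n \<and> 0 < Re (z / e) \<longrightarrow> \<psi> z \<in> N - {p} \<and> \<zeta> (\<psi> z) = z)"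
      using w(3) \<eta>r unfolding C_def by (intro exI[of _ "\<eta> \<circ> r"]) auto
  qed
qed

end

section \<open>Germs of primitives at regular points and at zeros\<close>

context vertical_cocycle
begin

text \<open>Both properties of a primitive in one formula: the horizontal part \<open>Re z\<close>
  has no effect and the vertical part adds \<open>\<Phi>\<close>. Only the germ of \<open>F\<close>
  at \<open>q\<close> is constrained.\<close>

definition local_primitive :: "'a \<Rightarrow> ('a \<Rightarrow> real) \<Rightarrow> bool" where
  "local_primitive q F \<longleftrightarrow> (\<forall>\<^sub>F z in nhds 0. F (displacement q z) = F q + \<Phi> q (Im z))"

lemma local_primitive_diff:
  assumes "q \<notin> form_zeros A \<omega>" "local_primitive q F" "local_primitive q F'"
  shows "\<forall>\<^sub>F y in nhds q. F y - F q = F' y - F' q"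
proof (rule eventually_displacement[OF assms(1)])
  show "\<forall>\<^sub>F z in nhds 0. F (displacement q z) - F q = F' (displacement q z) - F' q"
    using assms(2,3) unfolding local_primitive_def by eventually_elim simp
qed

lemma local_primitive_patchI:
  assumes "flat_patch C \<psi>" "z0 \<in> C" "\<forall>\<^sub>F z in nhds 0. F (\<psi> (z0 + z)) = F (\<psi> z0) + \<Phi> (\<psi> z0) (Im z)"
  shows "local_primitive (\<psi> z0) F"
  unfolding local_primitive_def
  using displacement_flat_patch[OF assms(1,2)] assms(3) by eventually_elim simp

lemma eventually_patch_shift:
  assumes "flat_patch C \<psi>" "z0 \<in> C"
  shows "\<forall>\<^sub>F z in nhds 0. z0 + z \<in> C \<and> z0 + of_real (Re z) \<in> C \<and> z0 + of_real (Im z) * \<i> \<in> C"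
proof -
  have "open ((\<lambda>z. z0 + z) -` C)" "open ((\<lambda>z. z0 + of_real (Re z)) -` C)"
    "open ((\<lambda>z. z0 + of_real (Im z) * \<i>) -` C)"
    by (intro open_vimage[OF flat_patch_open[OF assms(1)]] continuous_intros)+
  then have "\<forall>\<^sub>F z in nhds 0. z \<in> (\<lambda>z. z0 + z) -` C" "\<forall>\<^sub>F z in nhds 0. z \<in> (\<lambda>z. z0 + of_real (Re z)) -` C"
    "\<forall>\<^sub>F z in nhds 0. z \<in> (\<lambda>z. z0 + of_real (Im z) * \<i>) -` C"
    using assms(2) by (intro eventually_nhds_in_open; simp)+
  then show ?thesis by eventually_elim auto
qed

text \<open>\<open>F\<close> is \<open>\<Phi>\<close> from \<open>p\<close> to the height in the
  flat coordinate. At a point \<open>z0\<close>, holonomy moves the vertical arc to the vertical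
  axis through \<open>p\<close>, where the cocycle law applies.\<close>

lemma local_primitive_near_regular:
  assumes "p \<notin> form_zeros A \<omega>"
  obtains F where "F p = 0" "\<forall>\<^sub>F q in nhds p. q \<notin> form_zeros A \<omega> \<and> local_primitive q F"
proof -
  obtain \<rho> \<psi> where \<psi>: "\<rho> > 0" "flat_patch (ball 0 \<rho>) \<psi>" "\<psi> 0 = p"
    using assms by (rule regular_patch)
  define F where "F = (\<lambda>y. \<Phi> p (Im (inv_into (ball 0 \<rho>) \<psi> y)))"
  have F: "F (\<psi> z) = \<Phi> p (Im z)" if "z \<in> ball 0 \<rho>" for z
    using inv_into_f_f[OF flat_patch_inj[OF \<psi>(2)] that] by (simp add: F_def)
  have proj: "of_real (Im z) * \<i> \<in> ball 0 \<rho>" if "z \<in> ball 0 \<rho>" for z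
    using that abs_Im_le_cmod[of z] by (simp add: norm_mult)
  have "local_primitive (\<psi> z0) F" if z0: "z0 \<in> ball 0 \<rho>" for z0
  proof (rule local_primitive_patchI[OF \<psi>(2) z0])
    show "\<forall>\<^sub>F z in nhds 0. F (\<psi> (z0 + z)) = F (\<psi> z0) + \<Phi> (\<psi> z0) (Im z)"
      using eventually_patch_shift[OF \<psi>(2) z0]
    proof eventually_elim
      case (elim z)
      let ?u = "of_real (Im z0) * \<i>"
      have eq: "?u + of_real (Re z0) = z0" "?u + of_real (Im z) * \<i> = of_real (Im (z0 + z)) * \<i>"
        by (auto simp: complex_eq_iff)
      have "\<Phi> (\<psi> (?u + of_real (Re z0))) (Im z) = \<Phi> (\<psi> ?u) (Im z)"
        by (rule patch_holonomy[OF \<psi>(2)]) (use proj z0 elim in \<open>simp_all only: eq\<close>)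
      then have "\<Phi> (\<psi> z0) (Im z) = \<Phi> (\<psi> ?u) (Im z)" by (simp only: eq)
      moreover have "\<Phi> (\<psi> 0) (Im z0 + Im z) = \<Phi> (\<psi> 0) (Im z0) + \<Phi> (\<psi> (0 + ?u)) (Im z)"
        by (rule patch_cocycle[OF \<psi>(2)]) (use \<psi>(1) proj[OF z0] proj[of "z0 + z"] elim in simp_all)
      ultimately show ?case
        using F[OF z0] F[of "z0 + z"] elim \<psi>(3) by simp
    qed
  qed
  then have "q \<notin> form_zeros A \<omega> \<and> local_primitive q F" if "q \<in> \<psi> ` ball 0 \<rho>" for q
    using that flat_patch_regular[OF \<psi>(2)] by blast
  moreover have "open (\<psi> ` ball 0 \<rho>)" using flat_patch_image_open[OF \<psi>(2)] by blast
  moreover have "p \<in> \<psi> ` ball 0 \<rho>" using \<psi>(1,3) by force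
  ultimately have "\<forall>\<^sub>F q in nhds p. q \<notin> form_zeros A \<omega> \<and> local_primitive q F"
    unfolding eventually_nhds by blast
  moreover have "F p = 0"
    using F[of 0] \<psi>(1,3) patch_zero[OF \<psi>(2), of 0] by simp
  ultimately show thesis using that by blast
qed

text \<open>Changing the time by \<open>s\<close> changes the value by \<open>\<Phi>\<close> on an
  arc of length \<open>\<bar>s\<bar>\<close>, which the second condition of \<open>Bc_plus\<close>
  makes small.\<close>

lemma patch_tendsto:
  assumes P: "flat_patch C \<psi>" and C: "z \<in> C" "z + of_real t * \<i> \<in> C"
  shows "((\<lambda>s. \<Phi> (\<psi> z) (s + t)) \<longlongrightarrow> \<Phi> (\<psi> z) t) (at 0)"
proof (rule tendstoI)
  fix \<epsilon> :: real assume "\<epsilon> > 0"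
  then obtain \<delta> where \<delta>: "\<delta> > 0" "\<And>x t. \<bar>t\<bar> < \<delta> \<Longrightarrow> vflow_defined A \<omega> t x \<Longrightarrow> \<bar>\<Phi> x t\<bar> \<le> \<epsilon> / 2"
    using small[of "\<epsilon> / 2"] by auto
  have "open ((\<lambda>s. z + of_real (s + t) * \<i>) -` C)"
    by (intro open_vimage[OF flat_patch_open[OF P]] continuous_intros)
  then have "\<forall>\<^sub>F s in nhds 0. s \<in> (\<lambda>s. z + of_real (s + t) * \<i>) -` C"
    using C by (intro eventually_nhds_in_open) auto
  moreover have "\<forall>\<^sub>F s in nhds 0. s \<in> ball 0 \<delta>"
    using \<delta>(1) by (intro eventually_nhds_in_open) auto
  ultimately have "\<forall>\<^sub>F s in nhds 0. dist (\<Phi> (\<psi> z) (s + t)) (\<Phi> (\<psi> z) t) < \<epsilon>"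
  proof eventually_elim
    case (elim s)
    have s: "z + of_real (t + s) * \<i> \<in> C" "z + of_real t * \<i> + of_real s * \<i> \<in> C"
      using elim by (auto simp: algebra_simps)
    have "\<Phi> (\<psi> z) (t + s) = \<Phi> (\<psi> z) t + \<Phi> (\<psi> (z + of_real t * \<i>)) s"
      by (rule patch_cocycle[OF P C s(1)])
    moreover have "\<bar>\<Phi> (\<psi> (z + of_real t * \<i>)) s\<bar> \<le> \<epsilon> / 2"
      using elim flat_patch_flow(1)[OF P C(2) s(2)] by (intro \<delta>(2)) auto
    ultimately show ?case using \<open>\<epsilon> > 0\<close> by (simp add: dist_real_def add.commute)
  qed
  then show "\<forall>\<^sub>F s in at 0. dist (\<Phi> (\<psi> z) (s + t)) (\<Phi> (\<psi> z) t) < \<epsilon>"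
    using eventually_nhds_conv_at by blast
qed

text \<open>The bound on short arcs is uniform in the base point, so the values are uniformly
  continuous in the height \<open>s\<close> reached from \<open>z\<close>. They extend to height 0,
  the diameter of the half disc, where the arc may run into a zero.\<close>

lemma patch_boundary_limit:
  fixes h :: real
  assumes P: "flat_patch {z. cmod z < R \<and> 0 < Im z * h} \<psi>" and z: "cmod z < R" "0 < Im z * h"
  shows "\<exists>l. ((\<lambda>s. \<Phi> (\<psi> z) (s - Im z)) \<longlongrightarrow> l) (at 0 within {s. 0 < s * h})"
proof -
  let ?C = "{z. cmod z < R \<and> 0 < Im z * h}"
  \<comment> \<open>Heights below \<open>\<bar>Im z\<bar>\<close> keep the vertical segment within
    radius \<open>R\<close>; the restriction does not affect the limit at 0.\<close>
  define X where "X = {s. 0 < s * h} \<inter> {s. \<bar>s\<bar> < \<bar>Im z\<bar>}"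
  have inC: "z + of_real (s - Im z) * \<i> \<in> ?C" if "s \<in> X" for s
  proof -
    have "cmod (z + of_real (s - Im z) * \<i>) \<le> cmod z"
      using that unfolding cmod_def X_def by (intro real_sqrt_le_mono) (simp add: abs_le_square_iff[symmetric])
    with that z show ?thesis by (simp add: X_def)
  qed
  have "uniformly_continuous_on X (\<lambda>s. \<Phi> (\<psi> z) (s - Im z))"
    unfolding uniformly_continuous_on_def
  proof (intro allI impI)
    fix \<epsilon> :: real assume "\<epsilon> > 0"
    then obtain \<delta> where \<delta>: "\<delta> > 0" "\<And>x t. \<bar>t\<bar> < \<delta> \<Longrightarrow> vflow_defined A \<omega> t x \<Longrightarrow> \<bar>\<Phi> x t\<bar> \<le> \<epsilon> / 2"
      using small[of "\<epsilon> / 2"] by auto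
    have "dist (\<Phi> (\<psi> z) (s' - Im z)) (\<Phi> (\<psi> z) (s - Im z)) < \<epsilon>"
      if s: "s \<in> X" "s' \<in> X" "dist s' s < \<delta>" for s s'
    proof -
      let ?w = "z + of_real (s - Im z) * \<i>"
      have eq: "(s - Im z) + (s' - s) = s' - Im z" "?w + of_real (s' - s) * \<i> = z + of_real (s' - Im z) * \<i>"
        by (auto simp: algebra_simps)
      have "\<Phi> (\<psi> z) ((s - Im z) + (s' - s)) = \<Phi> (\<psi> z) (s - Im z) + \<Phi> (\<psi> ?w) (s' - s)"
        by (rule patch_cocycle[OF P]) (use z inC[OF s(1)] inC[OF s(2)] in \<open>simp_all only: eq mem_Collect_eq\<close>)
      moreover have "\<bar>\<Phi> (\<psi> ?w) (s' - s)\<bar> \<le> \<epsilon> / 2"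
        using s(3) flat_patch_flow(1)[OF P inC[OF s(1)], of "s' - s" \<i>] inC[OF s(2)]
        unfolding eq(2) by (intro \<delta>(2)) (auto simp: dist_real_def)
      ultimately show ?thesis using \<open>\<epsilon> > 0\<close> by (simp add: dist_real_def eq(1))
    qed
    with \<delta>(1) show "\<exists>d>0. \<forall>s\<in>X. \<forall>s'\<in>X. dist s' s < d \<longrightarrow>
        dist (\<Phi> (\<psi> z) (s' - Im z)) (\<Phi> (\<psi> z) (s - Im z)) < \<epsilon>" by blast
  qed
  moreover have "0 \<in> closure X"
    unfolding closure_approachable
  proof (intro allI impI)
    fix d :: real assume "d > 0"
    define m where "m = min (d / 2) (\<bar>Im z\<bar> / 2)"
    have "Im z \<noteq> 0" "h \<noteq> 0" using z(2) by auto
    then have "0 < m" "m < d" "m < \<bar>Im z\<bar>" using \<open>d > 0\<close> by (auto simp: m_def)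
    then show "\<exists>y\<in>X. dist y 0 < d"
      using \<open>h \<noteq> 0\<close> by (intro bexI[of _ "sgn h * m"]) (auto simp: X_def abs_mult sgn_if mult_pos_neg)
  qed
  ultimately obtain l where "((\<lambda>s. \<Phi> (\<psi> z) (s - Im z)) \<longlongrightarrow> l) (at 0 within X)"
    by (rule uniformly_continuous_on_extension_at_closure)
  moreover have "at 0 within X = at 0 within {s. 0 < s * h}"
  proof (rule at_within_nhd)
    show "0 \<in> ball (0::real) \<bar>Im z\<bar>" using z(2) by auto
  qed (auto simp: X_def)
  ultimately show ?thesis by auto
qed

text \<open>At a zero \<open>p\<close>, the primitive is normalised to vanish on the horizontal separatrices: its value
  at \<open>y\<close> is \<open>\<Phi>\<close> on the vertical arc from height \<open>0\<close> to \<open>y\<close>, a limit because this arc may start at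
  \<open>p\<close>.  The limits from the two sides of a horizontal separatrix agree by smallness of \<open>\<Phi>\<close> on
  short arcs, so there is no monodromy around \<open>p\<close>.\<close>

lemma local_primitive_near:
  obtains F where "F p = 0" "\<forall>\<^sub>F q in nhds p. q \<noteq> p \<longrightarrow> q \<notin> form_zeros A \<omega> \<and> local_primitive q F"
proof -
  obtain N \<zeta> R where N: "open N" "p \<in> N" and \<zeta>p: "\<zeta> p = 0"
    and \<zeta>: "\<And>q. q \<in> N - {p} \<Longrightarrow> \<zeta> q \<noteq> 0 \<and> cmod (\<zeta> q) < R"
    and half: "\<And>q e. q \<in> N - {p} \<Longrightarrow> cmod e = 1 \<Longrightarrow> 0 < Re (\<zeta> q / e) \<Longrightarrow>
       \<exists>\<psi>. flat_patch {z. cmod z < R \<and> 0 < Re (z / e)} \<psi> \<and> \<psi> (\<zeta> q) = q \<and>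
         (\<forall>z. cmod z < R \<and> 0 < Re (z / e) \<longrightarrow> \<psi> z \<in> N - {p} \<and> \<zeta> (\<psi> z) = z)"
    by (rule half_disc_patches[of p]) (rule that)
  \<comment> \<open>The value on the vertical arc from \<open>y\<close> to height \<open>s\<close>.
    This arc leaves \<open>y\<close>, whence the minus sign in \<open>F\<close>; \<open>S\<close>
    keeps \<open>s\<close> on the side of the axis on which \<open>y\<close> lies.\<close>
  define f where "f = (\<lambda>y s. \<Phi> y (s - Im (\<zeta> y)))"
  define S where "S = (\<lambda>h::real. {s. 0 < s * h})"
  define F where "F = (\<lambda>y. if Im (\<zeta> y) = 0 then 0 else - Lim (at 0 within S (Im (\<zeta> y))) (f y))"
  have nontriv: "at 0 within S h \<noteq> bot" if "h \<noteq> 0" for h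
  proof (cases "h > 0")
    case True
    then have "S h = {0<..}" by (auto simp: S_def zero_less_mult_iff)
    then show ?thesis by simp
  next
    case False
    with that have "S h = {..<0}" by (auto simp: S_def zero_less_mult_iff)
    then show ?thesis by simp
  qed
  have S_sgn: "S h = S k" if "0 < h * k" for h k
    using that by (auto simp: S_def zero_less_mult_iff)
  have F_lim: "F y = - l" if "Im (\<zeta> y) \<noteq> 0" "(f y \<longlongrightarrow> l) (at 0 within S (Im (\<zeta> y)))" for y l
    using that tendsto_Lim[OF nontriv[OF that(1)] that(2)] by (simp add: F_def)
  have regular: "q \<notin> form_zeros A \<omega>" if q: "q \<in> N - {p}" for q
  proof -
    \<comment> \<open>The half disc centred on the direction of \<open>\<zeta> q\<close> itself
      contains \<open>\<zeta> q\<close>.\<close>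
    define e where "e = \<zeta> q / of_real (cmod (\<zeta> q))"
    have nz: "\<zeta> q \<noteq> 0" "cmod (\<zeta> q) < R" using \<zeta>[OF q] by auto
    then have e: "\<zeta> q / e = of_real (cmod (\<zeta> q))" "cmod e = 1"
      by (auto simp: e_def norm_divide)
    then have pos: "0 < Re (\<zeta> q / e)" using nz by simp
    from half[OF q e(2) pos] obtain \<psi> where \<psi>: "flat_patch {z. cmod z < R \<and> 0 < Re (z / e)} \<psi>" "\<psi> (\<zeta> q) = q"
      by (elim exE conjE)
    from flat_patch_regular[OF \<psi>(1), of "\<zeta> q"] \<psi>(2) nz(2) pos show ?thesis by simp
  qed
  \<comment> \<open>For \<open>q\<close> on a horizontal separatrix, the right or left half disc
    contains both sides of the axis near \<open>\<zeta> q\<close>. Nearby vertical arcs reach the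
    axis away from \<open>p\<close>, so the limits in \<open>F\<close> are values of
    \<open>\<Phi>\<close>.\<close>
  have side: "local_primitive q F" if q: "q \<in> N - {p}" and im: "Im (\<zeta> q) = 0" for q
  proof -
    define \<sigma> where "\<sigma> = sgn (Re (\<zeta> q))"
    have "Re (\<zeta> q) \<noteq> 0" using \<zeta>[OF q] im by (auto simp: complex_eq_iff)
    then have \<sigma>: "\<sigma> = 1 \<or> \<sigma> = - 1" by (auto simp: \<sigma>_def sgn_if)
    have e: "cmod (of_real \<sigma>) = 1" "0 < Re (\<zeta> q / of_real \<sigma>)"
      using \<open>Re (\<zeta> q) \<noteq> 0\<close> by (auto simp: \<sigma>_def sgn_if)
    define C where "C = {z. cmod z < R \<and> 0 < Re (z / of_real \<sigma>)}"
    from half[OF q e, folded C_def] obtain \<psi> where P: "flat_patch C \<psi>" and \<psi>q: "\<psi> (\<zeta> q) = q"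
      and "\<forall>z. cmod z < R \<and> 0 < Re (z / of_real \<sigma>) \<longrightarrow> \<psi> z \<in> N - {p} \<and> \<zeta> (\<psi> z) = z"
      by (elim exE conjE)
    then have \<zeta>\<psi>: "\<zeta> (\<psi> z) = z" if "z \<in> C" for z using that by (simp add: C_def)
    have qC: "\<zeta> q \<in> C" using \<zeta>[OF q] e(2) by (simp add: C_def)
    have "local_primitive (\<psi> (\<zeta> q)) F"
    proof (rule local_primitive_patchI[OF P qC])
      show "\<forall>\<^sub>F z in nhds 0. F (\<psi> (\<zeta> q + z)) = F (\<psi> (\<zeta> q)) + \<Phi> (\<psi> (\<zeta> q)) (Im z)"
        using eventually_patch_shift[OF P qC]
      proof eventually_elim
        case (elim z)
        let ?y = "\<psi> (\<zeta> q + z)"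
        have \<zeta>y: "\<zeta> ?y = \<zeta> q + z" using \<zeta>\<psi> elim by blast
        have F0: "F (\<psi> (\<zeta> q)) = 0" by (simp add: \<psi>q F_def im)
        show ?case
        proof (cases "Im z = 0")
          case True
          then show ?thesis using F0 patch_zero[OF P qC] \<zeta>y im by (simp add: F_def)
        next
          case False
          have eq: "\<zeta> q + z + of_real (- Im z) * \<i> = \<zeta> q + of_real (Re z)"
            "\<zeta> q + of_real (Re z) + of_real (Im z) * \<i> = \<zeta> q + z"
            by (auto simp: complex_eq_iff)
          have "((\<lambda>s. \<Phi> ?y (s + (- Im z))) \<longlongrightarrow> \<Phi> ?y (- Im z)) (at 0)"
            by (rule patch_tendsto[OF P]) (use elim in \<open>simp_all only: eq\<close>)
          then have "(f ?y \<longlongrightarrow> \<Phi> ?y (- Im z)) (at 0 within S (Im (\<zeta> ?y)))"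
            using im unfolding f_def \<zeta>y
            by (auto intro: tendsto_within_subset[OF _ subset_UNIV])
          then have "F ?y = - \<Phi> ?y (- Im z)"
            using False \<zeta>y im by (intro F_lim) simp_all
          also have "\<dots> = \<Phi> (\<psi> (\<zeta> q + of_real (Re z))) (Im z)"
            using patch_minus[OF P, of "\<zeta> q + of_real (Re z)" "Im z"] elim unfolding eq by simp
          also have "\<dots> = \<Phi> (\<psi> (\<zeta> q)) (Im z)"
            by (rule patch_holonomy[OF P qC]) (use elim in \<open>simp_all only: eq\<close>)
          finally show ?thesis using F0 by simp
        qed
      qed
    qed
    then show ?thesis by (simp only: \<psi>q)
  qed
  \<comment> \<open>Off the axis, the upper or lower half disc is used; the axis is its boundary, so
    only limits are available.\<close>
  have above: "local_primitive q F" if q: "q \<in> N - {p}" and im: "Im (\<zeta> q) \<noteq> 0" for q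
  proof -
    define h where "h = Im (\<zeta> q)"
    define e where "e = \<i> * of_real (sgn h)"
    have "h \<noteq> 0" using im by (simp add: h_def)
    have Re_e: "0 < Re (z / e) \<longleftrightarrow> 0 < Im z * h" for z
    proof (cases "h > 0")
      case True
      then show ?thesis by (simp add: e_def zero_less_mult_iff Im_divide_of_real[symmetric] Re_divide power2_eq_square)
    next
      case False
      then show ?thesis using \<open>h \<noteq> 0\<close> by (simp add: e_def zero_less_mult_iff Re_divide power2_eq_square sgn_if)
    qed
    have e: "cmod e = 1" "0 < Re (\<zeta> q / e)"
      using \<open>h \<noteq> 0\<close> Re_e[of "\<zeta> q"] by (auto simp: e_def norm_mult sgn_if h_def zero_less_mult_iff linorder_neq_iff)
    define C where "C = {z. cmod z < R \<and> 0 < Im z * h}"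
    from half[OF q e, unfolded Re_e, folded C_def] obtain \<psi> where P: "flat_patch C \<psi>"
      and \<psi>q: "\<psi> (\<zeta> q) = q" and "\<forall>z. cmod z < R \<and> 0 < Im z * h \<longrightarrow> \<psi> z \<in> N - {p} \<and> \<zeta> (\<psi> z) = z"
      by (elim exE conjE)
    then have \<zeta>\<psi>: "\<zeta> (\<psi> z) = z" if "z \<in> C" for z using that by (simp add: C_def)
    have qC: "\<zeta> q \<in> C" using \<zeta>[OF q] e(2) unfolding Re_e by (simp add: C_def)
    have S_eq: "S (Im z) = S h" if "z \<in> C" for z
      using that by (intro S_sgn) (simp add: C_def)
    have im_nz: "Im z \<noteq> 0" if "z \<in> C" for z using that by (auto simp: C_def)
    have "\<exists>l. ((\<lambda>s. \<Phi> (\<psi> (\<zeta> q)) (s - Im (\<zeta> q))) \<longlongrightarrow> l) (at 0 within {s. 0 < s * h})"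
      using patch_boundary_limit[of R h \<psi> "\<zeta> q"] P qC unfolding C_def by simp
    then obtain l where l: "(f q \<longlongrightarrow> l) (at 0 within S h)"
      unfolding f_def S_def \<psi>q by blast
    then have Fq: "F q = - l" using F_lim[OF im] unfolding S_eq[OF qC] by blast
    have "local_primitive (\<psi> (\<zeta> q)) F"
    proof (rule local_primitive_patchI[OF P qC])
      show "\<forall>\<^sub>F z in nhds 0. F (\<psi> (\<zeta> q + z)) = F (\<psi> (\<zeta> q)) + \<Phi> (\<psi> (\<zeta> q)) (Im z)"
        using eventually_patch_shift[OF P qC]
      proof eventually_elim
        case (elim z)
        \<comment> \<open>The arcs from \<open>q\<close> and from its displacement \<open>?w\<close>
          to the same height \<open>s\<close> are compared: holonomy moves the second one
          horizontally to start at \<open>?w'\<close>, on the vertical line of \<open>q\<close>, and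
          the cocycle law splits it at \<open>q\<close>.\<close>
        let ?w = "\<zeta> q + z" and ?w' = "\<zeta> q + of_real (Im z) * \<i>"
        have wC: "?w \<in> C" "?w' \<in> C" using elim by auto
        have \<zeta>w: "\<zeta> (\<psi> ?w) = ?w" using \<zeta>\<psi> wC by blast
        have "\<forall>\<^sub>F s in at 0 within S h. f q s - \<Phi> q (Im z) = f (\<psi> ?w) s"
        proof -
          have "\<forall>\<^sub>F s in nhds (0::real). s \<in> ball 0 (min \<bar>Im ?w\<bar> \<bar>Im (\<zeta> q)\<bar>)"
            using im_nz[OF wC(1)] im_nz[OF qC] by (intro eventually_nhds_in_open) auto
          then show ?thesis unfolding eventually_at_filter
          proof eventually_elim
            fix s :: real assume s: "s \<in> ball 0 (min \<bar>Im ?w\<bar> \<bar>Im (\<zeta> q)\<bar>)"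
            show "s \<noteq> 0 \<longrightarrow> s \<in> S h \<longrightarrow> f q s - \<Phi> q (Im z) = f (\<psi> ?w) s"
            proof (intro impI)
              assume "s \<in> S h"
              then have sh: "0 < s * h" by (simp add: S_def)
              \<comment> \<open>Lowering the absolute height does not increase the modulus, so the
                moved points stay in the half disc.\<close>
              have move: "Complex (Re u) s \<in> C" if "u \<in> C" "\<bar>s\<bar> < \<bar>Im u\<bar>" for u
              proof -
                have "cmod (Complex (Re u) s) \<le> cmod u"
                  using that(2) unfolding cmod_def by (intro real_sqrt_le_mono) (simp add: abs_le_square_iff[symmetric])
                then show ?thesis using that(1) sh by (simp add: C_def)
              qed
              have s1: "Complex (Re ?w) s \<in> C" using s by (intro move wC) auto
              have s2: "Complex (Re (\<zeta> q)) s \<in> C" using s by (intro move qC) auto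
              have eq: "?w' + of_real (Re z) = ?w"
                "?w' + of_real (s - Im ?w) * \<i> = Complex (Re (\<zeta> q)) s"
                "?w + of_real (s - Im ?w) * \<i> = Complex (Re ?w) s"
                "?w' + of_real (- Im z) * \<i> = \<zeta> q"
                "?w' + of_real (- Im z + (s - Im (\<zeta> q))) * \<i> = Complex (Re (\<zeta> q)) s"
                "- Im z + (s - Im (\<zeta> q)) = s - Im ?w"
                by (auto simp: complex_eq_iff)
              have "f (\<psi> ?w) s = \<Phi> (\<psi> (?w' + of_real (Re z))) (s - Im ?w)"
                by (simp only: f_def \<zeta>w eq)
              also have "\<dots> = \<Phi> (\<psi> ?w') (s - Im ?w)"
                by (rule patch_holonomy[OF P wC(2)]) (use wC s1 s2 in \<open>simp_all only: eq\<close>)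
              also have "\<dots> = \<Phi> (\<psi> ?w') (- Im z + (s - Im (\<zeta> q)))" by (simp only: eq)
              also have "\<dots> = \<Phi> (\<psi> ?w') (- Im z) + \<Phi> (\<psi> (?w' + of_real (- Im z) * \<i>)) (s - Im (\<zeta> q))"
                by (rule patch_cocycle[OF P wC(2)]) (use qC s2 in \<open>simp_all only: eq\<close>)
              also have "\<dots> = - \<Phi> q (Im z) + f q s"
                using patch_minus[OF P qC wC(2)] unfolding eq \<psi>q by (simp add: f_def)
              finally show "f q s - \<Phi> q (Im z) = f (\<psi> ?w) s" by simp
            qed
          qed
        qed
        moreover have "((\<lambda>s. f q s - \<Phi> q (Im z)) \<longlongrightarrow> l - \<Phi> q (Im z)) (at 0 within S h)"
          by (intro tendsto_intros l)
        ultimately have "(f (\<psi> ?w) \<longlongrightarrow> l - \<Phi> q (Im z)) (at 0 within S h)"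
          by (rule Lim_transform_eventually[rotated])
        then have "F (\<psi> ?w) = - (l - \<Phi> q (Im z))"
          using im_nz[OF wC(1)] S_eq[OF wC(1)] \<zeta>w by (intro F_lim) simp_all
        then show ?case using Fq \<psi>q by simp
      qed
    qed
    then show ?thesis by (simp only: \<psi>q)
  qed
  have "\<forall>\<^sub>F q in nhds p. q \<in> N" using N by (rule eventually_nhds_in_open)
  then have "\<forall>\<^sub>F q in nhds p. q \<noteq> p \<longrightarrow> q \<notin> form_zeros A \<omega> \<and> local_primitive q F"
    by eventually_elim (use regular side above in blast)
  moreover have "F p = 0" by (simp add: F_def \<zeta>p)
  ultimately show thesis using that by blast
qed

section \<open>A choice of germs at all points\<close>

lemma primitives_exist:
  "\<exists>F. F p = 0 \<and> (\<forall>\<^sub>F q in nhds p. q \<noteq> p \<or> p \<notin> form_zeros A \<omega> \<longrightarrow>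
     q \<notin> form_zeros A \<omega> \<and> local_primitive q F)"
proof (cases "p \<in> form_zeros A \<omega>")
  case True
  obtain F where "F p = 0" "\<forall>\<^sub>F q in nhds p. q \<noteq> p \<longrightarrow> q \<notin> form_zeros A \<omega> \<and> local_primitive q F"
    by (rule local_primitive_near)
  with True show ?thesis by (intro exI[of _ F]) simp
next
  case False
  then obtain F where "F p = 0" "\<forall>\<^sub>F q in nhds p. q \<notin> form_zeros A \<omega> \<and> local_primitive q F"
    by (rule local_primitive_near_regular)
  with False show ?thesis by (intro exI[of _ F]) simp
qed

text \<open>The choices at different points are unrelated; local additivity only asks that nearby
  germs differ by constants.\<close>

definition primitive_at :: "'a \<Rightarrow> 'a \<Rightarrow> real" where
  "primitive_at p = (SOME F. F p = 0 \<and> (\<forall>\<^sub>F q in nhds p. q \<noteq> p \<or> p \<notin> form_zeros A \<omega> \<longrightarrow>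
     q \<notin> form_zeros A \<omega> \<and> local_primitive q F))"

lemma primitive_at:
  "primitive_at p p = 0"
  "\<forall>\<^sub>F q in nhds p. q \<noteq> p \<or> p \<notin> form_zeros A \<omega> \<longrightarrow>
     q \<notin> form_zeros A \<omega> \<and> local_primitive q (primitive_at p)"
  using someI_ex[OF primitives_exist[of p]] unfolding primitive_at_def by (rule conjunct1, rule conjunct2)

lemma local_primitive_at:
  "q \<notin> form_zeros A \<omega> \<Longrightarrow> local_primitive q (primitive_at q)"
  using eventually_nhds_x_imp_x[OF primitive_at(2)[of q]] by blast

text \<open>A point \<open>q\<close> near \<open>p\<close> and different from it is regular, and the
  germs chosen at \<open>p\<close> and at \<open>q\<close> are both local primitives there; hence
  they differ by a constant near \<open>q\<close>. For \<open>q = p\<close> the normalisation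
  suffices.\<close>

lemma locally_additive_primitive_at: "locally_additive primitive_at"
  unfolding locally_additive_def
proof
  fix p
  show "\<forall>\<^sub>F q in nhds p. \<forall>\<^sub>F y in nhds q. primitive_at q y = primitive_at p y - primitive_at p q"
    using primitive_at(2)[of p]
  proof eventually_elim
    case (elim q)
    show ?case
    proof (cases "q = p")
      case True
      then show ?thesis by (simp add: primitive_at(1))
    next
      case False
      with elim have q: "q \<notin> form_zeros A \<omega>" "local_primitive q (primitive_at p)" by auto
      from local_primitive_diff[OF q(1) local_primitive_at[OF q(1)] q(2)] show ?thesis
        by (simp add: primitive_at(1))
    qed
  qed
qed

section \<open>Primitives along flow arcs and rectangular curves\<close>

text \<open>Near time \<open>s\<close> the line moves by \<open>(r - s) * v\<close> in a flat
  coordinate, which treats both directions at once: the height gained is \<open>r - s\<close> for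
  \<open>v = \<i>\<close> and 0 for \<open>v = 1\<close>. The clause on \<open>flow_defined\<close>
  prepares the use of \<open>cocycle\<close>.\<close>

lemma primitive_at_flow_line:
  assumes g: "flow_line A \<omega> v t x g" and s: "s \<in> closed_segment 0 t"
  shows "\<forall>\<^sub>F r in nhds s. flow_defined A \<omega> v (r - s) (g s) \<and>
     (r \<in> closed_segment 0 t \<longrightarrow> primitive_at (g s) (g r) = \<Phi> (g s) (Im (of_real (r - s) * v)))"
proof -
  have "g s \<notin> form_zeros A \<omega>" using assms unfolding flow_line_def by blast
  then obtain \<rho> \<psi> where \<psi>: "\<rho> > 0" "flat_patch (ball 0 \<rho>) \<psi>" "\<psi> 0 = g s"
    by (rule regular_patch)
  have 0: "0 \<in> ball 0 \<rho>" using \<psi>(1) by simp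
  have "\<forall>\<^sub>F z in nhds 0. primitive_at (g s) (\<psi> z) = \<Phi> (g s) (Im z)"
    using local_primitive_at[OF \<open>g s \<notin> form_zeros A \<omega>\<close>] displacement_flat_patch[OF \<psi>(2) 0]
    unfolding local_primitive_def \<psi>(3) by eventually_elim (auto simp: primitive_at(1))
  moreover have "((\<lambda>r. of_real (r - s) * v) \<longlongrightarrow> of_real (s - s) * v) (nhds s)"
    by (intro tendsto_intros filterlim_ident)
  ultimately have "\<forall>\<^sub>F r in nhds s. primitive_at (g s) (\<psi> (of_real (r - s) * v)) =
      \<Phi> (g s) (Im (of_real (r - s) * v))"
    by (auto dest: filterlim_iff[THEN iffD1, rule_format])
  with flow_line_flat_patch[OF \<psi>(2) g s \<psi>(3)[symmetric] 0]
  show ?thesis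
  proof eventually_elim
    case (elim r)
    then show ?case using flat_patch_flow(1)[OF \<psi>(2) 0, of "r - s" v] \<psi>(3) by auto
  qed
qed

lemma vertical_primitive_along:
  assumes g: "flow_line A \<omega> \<i> t x g"
  shows "primitive_along primitive_at g (closed_segment 0 t) (\<Phi> x)"
  unfolding primitive_along_def
proof
  fix s assume s: "s \<in> closed_segment 0 t"
  show "\<forall>\<^sub>F r in nhds s. r \<in> closed_segment 0 t \<longrightarrow> \<Phi> x r - \<Phi> x s = primitive_at (g s) (g r)"
    using primitive_at_flow_line[OF g s]
  proof eventually_elim
    case (elim r)
    have "\<Phi> x (s + (r - s)) = \<Phi> x s + \<Phi> (g s) (r - s)"
      using cocycle[of s x "r - s"] flow_eq[OF flow_line_restrict[OF g s]] elim by simp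
    then show ?case using elim by simp
  qed
qed

lemma vertical_zero:
  assumes "flow_line A \<omega> \<i> t x g"
  shows "\<Phi> x 0 = 0"
  using cocycle[of 0 x 0] flow_eq[OF flow_line_restrict[OF assms, of 0]] assms
  unfolding flow_line_def by simp

lemma horizontal_primitive_along:
  assumes g: "flow_line A \<omega> 1 t x g"
  shows "primitive_along primitive_at g (closed_segment 0 t) (\<lambda>_. 0)"
  unfolding primitive_along_def
proof
  fix s assume s: "s \<in> closed_segment 0 t"
  then have "g s \<notin> form_zeros A \<omega>" using g unfolding flow_line_def by blast
  then obtain \<rho> \<psi> where \<psi>: "\<rho> > 0" "flat_patch (ball 0 \<rho>) \<psi>" "\<psi> 0 = g s"
    by (rule regular_patch)
  then have "\<Phi> (g s) 0 = 0" using patch_zero[OF \<psi>(2), of 0] by simp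
  with primitive_at_flow_line[OF g s]
  show "\<forall>\<^sub>F r in nhds s. r \<in> closed_segment 0 t \<longrightarrow> 0 - 0 = primitive_at (g s) (g r)"
    by (auto elim: eventually_mono)
qed

text \<open>The primitive is pulled back along the affine time change \<open>\<theta>\<close>. On a
  backward arc it runs from the length down to 0, which produces the sign in
  \<open>arc_value\<close>; \<open>vertical_zero\<close> removes the value at time 0.\<close>

lemma arc_primitive_along:
  assumes a: "is_flow_arc A \<omega> a"
  obtains \<phi> where "primitive_along primitive_at (arc_path A \<omega> a) {0..1} \<phi>"
    "\<phi> 1 - \<phi> 0 = (if vertical a then arc_value \<Phi> a else 0)"
proof -
  obtain g where g: "flow_line A \<omega> (arc_dir a) (arc_len a) (arc_base a) g" and len: "0 \<le> arc_len a"
    using a unfolding is_flow_arc_def flow_defined_def by blast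
  define \<theta> where "\<theta> = (\<lambda>u. arc_len a * (if forward a then u else 1 - u))"
  define \<phi> where "\<phi> = (if vertical a then \<Phi> (arc_base a) else (\<lambda>_. 0))"
  have \<theta>: "\<theta> ` {0..1} \<subseteq> closed_segment 0 (arc_len a)"
    using len by (auto simp: \<theta>_def closed_segment_eq_real_ivl mult_left_le)
  have "continuous_on {0..1} \<theta>"
    unfolding \<theta>_def by (cases "forward a") (auto intro!: continuous_intros)
  moreover have "primitive_along primitive_at g (closed_segment 0 (arc_len a)) \<phi>"
    using g vertical_primitive_along horizontal_primitive_along
    by (cases "vertical a") (auto simp: \<phi>_def arc_dir_def)
  ultimately have "primitive_along primitive_at (g \<circ> \<theta>) {0..1} (\<phi> \<circ> \<theta>)"
    using \<theta> primitive_along_compose by blast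
  moreover have "(g \<circ> \<theta>) u = arc_path A \<omega> a u" if "u \<in> {0..1}" for u
  proof -
    have "\<theta> u \<in> closed_segment 0 (arc_len a)" using \<theta> that by blast
    from flow_eq(2)[OF flow_line_restrict[OF g this]] show ?thesis
      by (simp add: arc_path_def \<theta>_def)
  qed
  ultimately have "primitive_along primitive_at (arc_path A \<omega> a) {0..1} (\<phi> \<circ> \<theta>)"
    by (rule primitive_along_cong) auto
  moreover have "(\<phi> \<circ> \<theta>) 1 - (\<phi> \<circ> \<theta>) 0 = (if vertical a then arc_value \<Phi> a else 0)"
    using vertical_zero g by (auto simp: \<phi>_def \<theta>_def arc_value_def arc_dir_def)
  ultimately show thesis by (rule that)
qed

text \<open>A primitive along the whole curve has on each piece the same increment as the
  reparametrised primitive of the arc, and these increments telescope.\<close>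

lemma curve_value_eq_increment:
  assumes "rectangular_closed_curve A \<omega> \<gamma> as"
  shows "curve_value \<Phi> as = increment primitive_at \<gamma>"
proof -
  obtain \<phi> where \<phi>: "primitive_along primitive_at \<gamma> {0..1} \<phi>"
    using assms primitive_along_path[OF locally_additive_primitive_at]
    unfolding rectangular_closed_curve_def by blast
  obtain s :: "nat \<Rightarrow> real" where s: "s 0 = 0" "s (length as) = 1"
    and piece: "\<And>j. j < length as \<Longrightarrow> s j < s (Suc j) \<and>
       (\<exists>\<theta>. continuous_on {s j..s (Suc j)} \<theta> \<and> mono_on {s j..s (Suc j)} \<theta> \<and>
            \<theta> (s j) = 0 \<and> \<theta> (s (Suc j)) = 1 \<and>
            (\<forall>u \<in> {s j..s (Suc j)}. \<gamma> u = arc_path A \<omega> (as ! j) (\<theta> u)))"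
    using assms unfolding rectangular_closed_curve_def concatenation_def by metis
  have s_mono: "s i \<le> s j" if "i \<le> j" "j \<le> length as" for i j
    using that
  proof (induction j rule: dec_induct)
    case (step j)
    then show ?case using piece[of j] by fastforce
  qed simp
  have inc: "\<phi> (s (Suc j)) - \<phi> (s j) = (if vertical (as ! j) then arc_value \<Phi> (as ! j) else 0)"
    if j: "j < length as" for j
  proof -
    obtain \<theta> where \<theta>: "continuous_on {s j..s (Suc j)} \<theta>" "mono_on {s j..s (Suc j)} \<theta>"
      "\<theta> (s j) = 0" "\<theta> (s (Suc j)) = 1" "\<And>u. u \<in> {s j..s (Suc j)} \<Longrightarrow> \<gamma> u = arc_path A \<omega> (as ! j) (\<theta> u)"
      and less: "s j < s (Suc j)"
      using piece[OF j] by blast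
    have "is_flow_arc A \<omega> (as ! j)"
      using assms j unfolding rectangular_closed_curve_def by simp
    then obtain \<phi>' where \<phi>': "primitive_along primitive_at (arc_path A \<omega> (as ! j)) {0..1} \<phi>'"
      "\<phi>' 1 - \<phi>' 0 = (if vertical (as ! j) then arc_value \<Phi> (as ! j) else 0)"
      by (rule arc_primitive_along)
    \<comment> \<open>Monotonicity confines \<open>\<theta>\<close> to \<open>{0..1}\<close>, where
      the primitive of the arc is available.\<close>
    have "\<theta> ` {s j..s (Suc j)} \<subseteq> {0..1}"
    proof
      fix y assume "y \<in> \<theta> ` {s j..s (Suc j)}"
      then obtain u where u: "u \<in> {s j..s (Suc j)}" "y = \<theta> u" by blast
      then have "\<theta> (s j) \<le> \<theta> u" "\<theta> u \<le> \<theta> (s (Suc j))"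
        using less by (auto intro!: mono_onD[OF \<theta>(2)])
      then show "y \<in> {0..1}" using \<theta>(3,4) u(2) by simp
    qed
    then have "primitive_along primitive_at (arc_path A \<omega> (as ! j) \<circ> \<theta>) {s j..s (Suc j)} (\<phi>' \<circ> \<theta>)"
      using primitive_along_compose[OF \<phi>'(1) \<theta>(1)] by blast
    then have lifted: "primitive_along primitive_at \<gamma> {s j..s (Suc j)} (\<phi>' \<circ> \<theta>)"
      by (rule primitive_along_cong) (use \<theta>(5) in auto)
    have "{s j..s (Suc j)} \<subseteq> {0..1}"
      using s_mono[of 0 j] s_mono[of "Suc j" "length as"] j s by auto
    then have "primitive_along primitive_at \<gamma> {s j..s (Suc j)} \<phi>"
      using primitive_along_subset[OF \<phi>] by blast
    from primitive_along_diff_const[OF connected_Icc this lifted, of "s j" "s (Suc j)"]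
    have "\<phi> (s (Suc j)) - \<phi> (s j) = (\<phi>' \<circ> \<theta>) (s (Suc j)) - (\<phi>' \<circ> \<theta>) (s j)"
      using less by simp
    then show ?thesis using \<phi>'(2) \<theta>(3,4) by simp
  qed
  have "curve_value \<Phi> as = (\<Sum>a\<leftarrow>as. if vertical a then arc_value \<Phi> a else 0)"
    unfolding curve_value_def by (rule sum_list_map_filter')
  also have "\<dots> = (\<Sum>j<length as. \<phi> (s (Suc j)) - \<phi> (s j))"
    using inc by (simp add: sum_list_sum_nth atLeast0LessThan)
  also have "\<dots> = \<phi> 1 - \<phi> 0"
    using sum_lessThan_telescope[of "\<lambda>n. \<phi> (s n)" "length as"] by (simp add: s)
  finally show ?thesis using increment_eq[OF \<phi>] by simp
qed

end

theorem proposition1p22: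
  fixes A :: "'a::t2_space chart set" and \<omega> :: "'a form"
    and k :: nat and \<gamma> :: "nat \<Rightarrow> real \<Rightarrow> 'a" and arcs :: "nat \<Rightarrow> 'a flow_arc list"
    and \<Phi> :: "'a \<Rightarrow> real \<Rightarrow> real"
  assumes "abelian_differential A \<omega>"
    and "\<And>i. i \<in> {1..k} \<Longrightarrow> rectangular_closed_curve A \<omega> (\<gamma> i) (arcs i)"
    and "homologous_rel 1 euclidean {} (\<Sum>i=1..k. frag_of (curve_simplex (\<gamma> i))) 0"
    and "\<Phi> \<in> Bc_plus A \<omega>"
  shows "(\<Sum>i=1..k. curve_value \<Phi> (arcs i)) = 0"
proof -
  interpret holomorphic_form A \<omega>
    using assms(1) by unfold_locales (auto simp: abelian_differential_def compact_Riemann_surface_def)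
  interpret abelian_form A \<omega>
    using assms(1) by (intro abelian_form_of_connected)
      (auto simp: abelian_differential_def compact_Riemann_surface_def)
  interpret vertical_cocycle A \<omega> \<Phi>
    using assms(4) by unfold_locales
  have "(\<Sum>i=1..k. curve_value \<Phi> (arcs i)) = (\<Sum>i=1..k. increment primitive_at (\<gamma> i))"
    using assms(2) by (intro sum.cong refl curve_value_eq_increment)
  also have "\<dots> = 0"
    by (rule sum_increment_null_homologous[OF locally_additive_primitive_at assms(3)])
  finally show ?thesis .
qed

end
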